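(* Let $n \ge 3$. There are $2^{\aleph_0}$ infinite-index maximal subgroups in $\mathrm{SL}(n,\mathbb{Z})$.
   Context: A maximal subgroup of a group $G$ is a proper subgroup that is not contained in any other proper subgroup of $G$. *)

theory Defs
  imports
    "HOL-Algebra.Coset"
    "HOL-Library.Equipollence"
    "Jordan_Normal_Form.Determinant"
begin

definition SLZ :: "nat \<Rightarrow> int mat monoid" where
  "SLZ n = \<lparr>carrier = {A \<in> carrier_mat n n. det A = 1}, monoid.mult = (*), one = 1\<^sub>m n\<rparr>"

lemma group_SLZ: "group (SLZ n)"
proof (rule groupI)
  fix A assume "A \<in> carrier (SLZ n)"
  then have A: "A \<in> carrier_mat n n" and d: "det A = 1" by (auto simp: SLZ_def)
  have inv: "adj_mat A * A = 1\<^sub>m n" and c: "adj_mat A \<in> carrier_mat n n"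
    using adj_mat[OF A] d by auto
  have "det (adj_mat A) = 1"
    using det_mult[OF c A] inv d by simp
  with inv c show "\<exists>B\<in>carrier (SLZ n). B \<otimes>\<^bsub>SLZ n\<^esub> A = \<one>\<^bsub>SLZ n\<^esub>"
    by (auto simp: SLZ_def)
qed (auto simp: SLZ_def det_mult)

definition proper_subgroup :: "'a set \<Rightarrow> ('a, 'b) monoid_scheme \<Rightarrow> bool" where
  "proper_subgroup H G \<longleftrightarrow> subgroup H G \<and> H \<noteq> carrier G"

definition maximal_subgroup :: "'a set \<Rightarrow> ('a, 'b) monoid_scheme \<Rightarrow> bool" where
  "maximal_subgroup M G \<longleftrightarrow>
     proper_subgroup M G \<and> \<not> (\<exists>H. proper_subgroup H G \<and> H \<noteq> M \<and> M \<subseteq> H)"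

definition infinite_index :: "'a set \<Rightarrow> ('a, 'b) monoid_scheme \<Rightarrow> bool" where
  "infinite_index H G \<longleftrightarrow> infinite (rcosets\<^bsub>G\<^esub> H)"

end

theory Submission
  imports Defs "HOL-Algebra.Generated_Groups" "HOL-Library.Countable_Set"
begin

text \<open>
The group \<open>G = SL(n, \<int>)\<close> is countable, so it has at most continuum many subgroups. For the
converse the idea is to grow ascending chains of subgroups in which, at every stage, one of two
finite subgroups \<open>A\<close>, \<open>B\<close> with \<open>\<langle>A, B\<rangle> = G\<close> is added after conjugation by the same element
\<open>\<gamma>\<close>. The choices along a chain are coded by a set of natural numbers. As \<open>G\<close> is finitely
generated, the union of a chain of proper subgroups is proper and lies in a maximal subgroup. Two
chains that part company at some stage cannot share a maximal subgroup, for it would contain both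
\<open>\<gamma> A \<gamma>\<inverse>\<close> and \<open>\<gamma> B \<gamma>\<inverse>\<close>, hence everything. For infinite index the conjugator of stage
\<open>k\<close> is taken to be a \<open>k!\<close>-th power: a subgroup of index at most \<open>k\<close> contains all such powers,
so it would contain \<open>A\<close> and \<open>B\<close> themselves once both choices occur at arbitrarily late
stages. This is \<open>continuum_many_maximal_subgroups\<close>, a statement about abstract groups.

For \<open>A\<close> one takes the signed permutation matrices of determinant 1 and for \<open>B\<close> a group of
order 2; together they generate \<open>G\<close> because an elementary matrix is a product of two
involutions, one of which is diagonal (\<open>generate_SLZ\<close>).

What keeps the chains proper is a ping-pong argument on rational vectors. Call a subgroup \<open>H\<close>
displacing if there are a hyperplane, given by a covector \<open>\<phi>\<close>, and a vector \<open>v\<close> in it such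
that every nonscalar \<open>h \<in> H\<close> moves \<open>v\<close> off the hyperplane, and this persists for all vectors and
covectors in a fixed neighbourhood of \<open>v\<close> and \<open>\<phi>\<close>. Such an \<open>H\<close> is proper, since the
transvection \<open>x \<mapsto> x + N \<phi>(x) v\<close> fixes \<open>v\<close>. Let \<open>\<gamma>\<close> be this transvection with \<open>N\<close>
large, and let \<open>f\<close> be a matrix with \<open>\<phi>(f v) \<noteq> 0\<close>. Then
\<open>\<gamma> f \<gamma>\<inverse>\<close> is \<open>- N\<^sup>2 \<phi>(f v) v \<phi>\<close> up to an error of order \<open>N\<close>, so it throws all
vectors that are not too close to the hyperplane into a narrow cone around \<open>v\<close>
(\<open>conjugate_contracts\<close>). The nonscalar elements of \<open>H\<close> throw that cone back off the hyperplane.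
Hence \<open>H\<close> and \<open>\<gamma> F \<gamma>\<inverse>\<close>, for a finite group \<open>F\<close>, play ping-pong, and they generate
a displacing subgroup again, for a slightly perturbed pair (\<open>displacing_extend\<close>).
\<close>

section \<open>Maximal subgroups from chains of proper subgroups\<close>

definition conjugate_set :: "('a, 'b) monoid_scheme \<Rightarrow> 'a \<Rightarrow> 'a set \<Rightarrow> 'a set" where
  "conjugate_set G g A = (\<lambda>x. g \<otimes>\<^bsub>G\<^esub> x \<otimes>\<^bsub>G\<^esub> inv\<^bsub>G\<^esub> g) ` A"

context group
begin

lemma cancel_inv:
  assumes "g \<in> carrier G" "x \<in> carrier G"
  shows "inv g \<otimes> (g \<otimes> x) = x" "g \<otimes> (inv g \<otimes> x) = x"
  using assms by (simp_all flip: m_assoc)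

lemma conjugate_set_subset_carrier:
  assumes "g \<in> carrier G" "A \<subseteq> carrier G"
  shows "conjugate_set G g A \<subseteq> carrier G"
  using assms by (auto simp: conjugate_set_def)

lemma subset_if_conjugate_set_subset:
  assumes M: "subgroup M G" and g: "g \<in> M" and A: "A \<subseteq> carrier G"
    and sub: "conjugate_set G g A \<subseteq> M"
  shows "A \<subseteq> M"
proof
  fix x assume x: "x \<in> A"
  have gc: "g \<in> carrier G" by (rule subgroup.mem_carrier[OF M g])
  have xc: "x \<in> carrier G" using x A by blast
  have "g \<otimes> x \<otimes> inv g \<in> M" using sub x by (auto simp: conjugate_set_def)
  then have "inv g \<otimes> (g \<otimes> x \<otimes> inv g) \<otimes> g \<in> M"
    using subgroup.m_closed[OF M subgroup.m_closed[OF M subgroup.m_inv_closed[OF M g]] g] by blast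
  moreover have "inv g \<otimes> (g \<otimes> x \<otimes> inv g) \<otimes> g = x"
    using gc xc by (simp add: m_assoc cancel_inv)
  ultimately show "x \<in> M" by simp
qed

lemma subgroup_conjugate_set:
  assumes F: "subgroup F G" and g: "g \<in> carrier G"
  shows "subgroup (conjugate_set G g F) G"
proof (rule subgroupI)
  have Fc: "F \<subseteq> carrier G" using F subgroup.subset by blast
  show "conjugate_set G g F \<subseteq> carrier G" using conjugate_set_subset_carrier[OF g Fc] .
  show "conjugate_set G g F \<noteq> {}"
    using subgroup.one_closed[OF F] by (auto simp: conjugate_set_def)
next
  fix a assume "a \<in> conjugate_set G g F"
  then obtain x where x: "x \<in> F" "a = g \<otimes> x \<otimes> inv g" by (auto simp: conjugate_set_def)
  have xc: "x \<in> carrier G" by (rule subgroup.mem_carrier[OF F x(1)])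
  have "inv a = g \<otimes> inv x \<otimes> inv g"
    using x g xc by (simp add: inv_mult_group m_assoc)
  then show "inv a \<in> conjugate_set G g F"
    using subgroup.m_inv_closed[OF F x(1)] by (auto simp: conjugate_set_def)
next
  fix a b assume "a \<in> conjugate_set G g F" "b \<in> conjugate_set G g F"
  then obtain x y where x: "x \<in> F" "a = g \<otimes> x \<otimes> inv g" and y: "y \<in> F" "b = g \<otimes> y \<otimes> inv g"
    by (auto simp: conjugate_set_def)
  have xc: "x \<in> carrier G" "y \<in> carrier G" using subgroup.mem_carrier[OF F] x(1) y(1) by auto
  have "a \<otimes> b = g \<otimes> (x \<otimes> y) \<otimes> inv g"
    using x y g xc by (simp add: m_assoc cancel_inv)
  then show "a \<otimes> b \<in> conjugate_set G g F"
    using subgroup.m_closed[OF F x(1) y(1)] by (auto simp: conjugate_set_def)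
qed

lemma subgroup_Union_chain:
  assumes "C \<noteq> {}" "subset.chain {H. subgroup H G} C"
  shows "subgroup (\<Union>C) G"
proof (rule subgroupI)
  have sg: "subgroup H G" if "H \<in> C" for H using assms(2) that by (auto simp: subset_chain_def)
  show "\<Union>C \<subseteq> carrier G" using sg subgroup.subset by blast
  show "\<Union>C \<noteq> {}" using assms(1) sg subgroup.one_closed by blast
  show "inv a \<in> \<Union>C" if "a \<in> \<Union>C" for a using that subgroup.m_inv_closed[OF sg] by auto
  show "a \<otimes> b \<in> \<Union>C" if ab: "a \<in> \<Union>C" "b \<in> \<Union>C" for a b
  proof -
    obtain H K where HK: "H \<in> C" "a \<in> H" "K \<in> C" "b \<in> K" using ab by blast
    have "H \<subseteq> K \<or> K \<subseteq> H"
      using assms(2) HK by (auto simp: subset_chain_def)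
    then obtain L where L: "L \<in> C" "a \<in> L" "b \<in> L" using HK by blast
    then show ?thesis using subgroup.m_closed[OF sg[OF L(1)] L(2,3)] by auto
  qed
qed

text \<open>
If the union were everything, the finitely many generators would all lie in one member of the chain.
\<close>

lemma proper_subgroup_Union_chain:
  assumes X: "finite X" "X \<subseteq> carrier G" "generate G X = carrier G"
    and C: "C \<noteq> {}" "subset.chain {H. proper_subgroup H G} C"
  shows "proper_subgroup (\<Union>C) G"
proof -
  have sg: "subset.chain {H. subgroup H G} C"
    using C(2) by (auto simp: subset_chain_def proper_subgroup_def)
  have "\<Union>C \<noteq> carrier G"
  proof
    assume eq: "\<Union>C = carrier G"
    obtain H where H: "H \<in> C" "X \<subseteq> H"
      using finite_subset_Union_chain[OF X(1) _ C(1) sg] X(2) eq by blast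
    have "proper_subgroup H G" using H C(2) by (auto simp: subset_chain_def)
    then have "subgroup H G" "H \<noteq> carrier G" by (auto simp: proper_subgroup_def)
    moreover have "carrier G \<subseteq> H" using generate_subgroup_incl[OF H(2) \<open>subgroup H G\<close>] X(3) by simp
    ultimately show False using subgroup.subset by blast
  qed
  then show ?thesis using subgroup_Union_chain[OF C(1) sg] by (simp add: proper_subgroup_def)
qed

lemma ex_maximal_subgroup:
  assumes X: "finite X" "X \<subseteq> carrier G" "generate G X = carrier G"
    and H: "proper_subgroup H G"
  shows "\<exists>M. maximal_subgroup M G \<and> H \<subseteq> M"
proof -
  let ?S = "{K. proper_subgroup K G \<and> H \<subseteq> K}"
  have "\<exists>M\<in>?S. \<forall>K\<in>?S. M \<subseteq> K \<longrightarrow> K = M"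
  proof (rule subset_Zorn_nonempty)
    show "?S \<noteq> {}" using H by blast
    fix C assume C: "C \<noteq> {}" "subset.chain ?S C"
    then have "subset.chain {H. proper_subgroup H G} C" by (auto simp: subset_chain_def)
    moreover have "H \<subseteq> \<Union>C" using C unfolding subset_chain_def by blast
    ultimately show "\<Union>C \<in> ?S" using proper_subgroup_Union_chain[OF X C(1)] by blast
  qed
  then obtain M where M: "proper_subgroup M G" "H \<subseteq> M"
    and max: "\<And>K. proper_subgroup K G \<Longrightarrow> H \<subseteq> K \<Longrightarrow> M \<subseteq> K \<Longrightarrow> K = M"
    by auto
  have "maximal_subgroup M G"
    unfolding maximal_subgroup_def using M max by blast
  then show ?thesis using M(2) by blast
qed

text \<open>
Among the cosets of \<open>1, x, \<dots>, x\<^sup>k\<close> two coincide, so \<open>M\<close> contains \<open>x\<^sup>d\<close> for some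
\<open>1 \<le> d \<le> k\<close>; the factorial is a multiple of every such \<open>d\<close> and does not depend on \<open>x\<close>.
\<close>

lemma pow_fact_mem_finite_index:
  assumes M: "subgroup M G" and fin: "finite (rcosets M)" and k: "card (rcosets M) \<le> k"
    and x: "x \<in> carrier G"
  shows "x [^] (fact k :: nat) \<in> M"
proof -
  have Mc: "M \<subseteq> carrier G" using M subgroup.subset by blast
  have "(\<lambda>i::nat. M #> x [^] i) ` {..k} \<subseteq> rcosets M"
    using rcosetsI[OF Mc] x by auto
  then have "card ((\<lambda>i::nat. M #> x [^] i) ` {..k}) \<le> card (rcosets M)"
    using fin card_mono by blast
  then have "card ((\<lambda>i::nat. M #> x [^] i) ` {..k}) < card {..k}" using k by simp
  then have "\<not> inj_on (\<lambda>i::nat. M #> x [^] i) {..k}" using pigeonhole by blast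
  then obtain i j :: nat where ij: "i < j" "j \<le> k" "M #> x [^] i = M #> x [^] j"
    unfolding inj_on_def by (metis atMost_iff linorder_neqE_nat)
  have "x [^] j \<in> M #> x [^] i"
    using ij(3) rcos_self[OF _ M, of "x [^] j"] x by simp
  then obtain m where m: "m \<in> M" "x [^] j = m \<otimes> x [^] i" by (auto simp: r_coset_def)
  have mc: "m \<in> carrier G" using m Mc by blast
  have "x [^] (j - i) \<otimes> x [^] i = x [^] j" using ij(1) x by (simp add: nat_pow_mult)
  then have "x [^] (j - i) = m" using m(2) mc x by (metis nat_pow_closed right_cancel)
  then have "x [^] (j - i) \<in> M" using m by simp
  moreover have "(j - i) dvd fact k" using ij by (intro dvd_fact) auto
  then obtain q :: nat where "fact k = (j - i) * q" by (auto simp: dvd_def)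
  ultimately have "x [^] (fact k :: nat) = (x [^] (j - i)) [^] q \<and> x [^] (j - i) \<in> M"
    using x by (simp add: nat_pow_pow)
  then show ?thesis
    using subgroup_int_pow_closed[OF M, of "x [^] (j - i)" "int q"] by (simp add: int_pow_int)
qed

text \<open>
The predicate \<open>P\<close> is whatever invariant guarantees that the chains can be continued and stay
proper. The conjugator of a stage depends only on the subgroup reached so far and on the number of
the stage, so two chains that agree up to that stage use the same one.
\<close>

theorem continuum_many_maximal_subgroups:
  assumes fin: "finite A" "finite B" and AB: "A \<subseteq> carrier G" "B \<subseteq> carrier G"
    and gen: "generate G (A \<union> B) = carrier G"
    and start: "P H0"
    and proper: "\<And>H. P H \<Longrightarrow> proper_subgroup H G"
    and step: "\<And>H m. P H \<Longrightarrow> m > 0 \<Longrightarrow>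
      \<exists>t\<in>carrier G. \<forall>F\<in>{A, B}. P (generate G (H \<union> conjugate_set G (t [^] (m::nat)) F))"
  shows "\<exists>M :: nat set \<Rightarrow> 'a set. inj M \<and>
    range M \<subseteq> {M. maximal_subgroup M G \<and> infinite_index M G}"
proof -
  obtain t where t: "\<And>H m. P H \<Longrightarrow> m > 0 \<Longrightarrow> t H m \<in> carrier G"
    and tP: "\<And>H m F. P H \<Longrightarrow> m > 0 \<Longrightarrow> F \<in> {A, B} \<Longrightarrow>
      P (generate G (H \<union> conjugate_set G (t H m [^] (m::nat)) F))"
    using step by metis
  define g where "g H k = t H (fact k) [^] (fact k :: nat)" for H k
  have gc: "g H k \<in> carrier G" if "P H" for H k
    unfolding g_def using t[OF that, of "fact k"] by simp
  define chain where "chain c = rec_nat H0 (\<lambda>k H. generate G (H \<union> conjugate_set G (g H k) (if c k then A else B)))"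
    for c :: "nat \<Rightarrow> bool"
  have chain0: "chain c 0 = H0" for c by (simp add: chain_def)
  have chainS: "chain c (Suc k) = generate G (chain c k \<union>
      conjugate_set G (g (chain c k) k) (if c k then A else B))" for c k
    by (simp add: chain_def)
  have chainP: "P (chain c k)" for c k
  proof (induction k)
    case 0 then show ?case using start by (simp add: chain0)
  next
    case (Suc k) then show ?case unfolding chainS g_def by (intro tP) auto
  qed
  have mono: "chain c k \<subseteq> chain c l" if "k \<le> l" for c k l
    using that
  proof (rule lift_Suc_mono_le[rotated])
    show "chain c n \<subseteq> chain c (Suc n)" for n unfolding chainS by (auto intro: generate.incl)
  qed
  have added: "conjugate_set G (g (chain c k) k) (if c k then A else B) \<subseteq> chain c (Suc k)" for c k
    unfolding chainS by (auto intro: generate.incl)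
  have cong: "chain c k = chain d k" if "\<And>i. i < k \<Longrightarrow> c i = d i" for c d k
    using that by (induction k) (auto simp: chain0 chainS)
  have "proper_subgroup (\<Union>(range (chain c))) G" for c
  proof (rule proper_subgroup_Union_chain)
    show "finite (A \<union> B)" "A \<union> B \<subseteq> carrier G" "generate G (A \<union> B) = carrier G"
      using fin AB gen by auto
    have "chain c k \<subseteq> chain c l \<or> chain c l \<subseteq> chain c k" for k l
      using mono[of k l] mono[of l k] by (cases "k \<le> l") auto
    then show "subset.chain {H. proper_subgroup H G} (range (chain c))"
      using proper chainP by (auto simp: subset_chain_def)
  qed simp
  then have "\<forall>c. \<exists>M. maximal_subgroup M G \<and> \<Union>(range (chain c)) \<subseteq> M"
    using ex_maximal_subgroup[of "A \<union> B"] fin AB gen by auto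
  then obtain N where N: "\<And>c. maximal_subgroup (N c) G" "\<And>c. \<Union>(range (chain c)) \<subseteq> N c"
    by metis
  have sgN: "subgroup (N c) G" and neN: "N c \<noteq> carrier G" for c
    using N(1)[of c] by (auto simp: maximal_subgroup_def proper_subgroup_def)
  have not_both: False if "A \<subseteq> N c" "B \<subseteq> N c" for c
    using generate_subgroup_incl[of "A \<union> B", OF _ sgN] that gen neN[of c] subgroup.subset[OF sgN]
    by blast
  have conjN: "conjugate_set G (g (chain c k) k) (if c k then A else B) \<subseteq> N c" for c k
    using added[of c k] N(2)[of c] by blast
  \<comment> \<open>Each choice is followed by its opposite, so that both occur infinitely often in every
    chain; the infinite index rests on this, while the even stages alone recover the set.\<close>
  define code where "code f k = (if even k then k div 2 \<in> f else k div 2 \<notin> f)" for f :: "nat set" and k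
  have "inj (\<lambda>f. N (code f))"
  proof (rule injI, rule ccontr)
    fix f f' assume eq: "N (code f) = N (code f')" and "f \<noteq> f'"
    then obtain i where i: "(i \<in> f) \<noteq> (i \<in> f')" by blast
    have "code f (2 * i) \<noteq> code f' (2 * i)" using i by (simp add: code_def)
    then obtain k where k: "code f k \<noteq> code f' k" "\<And>j. j < k \<Longrightarrow> code f j = code f' j"
      using exists_least_iff[of "\<lambda>k. code f k \<noteq> code f' k"] by blast
    have same: "chain (code f) k = chain (code f') k" using cong k(2) by blast
    define x where "x = g (chain (code f) k) k"
    have x: "x \<in> carrier G" unfolding x_def using gc chainP by blast
    have conj_AB: "conjugate_set G x A \<subseteq> N (code f)" "conjugate_set G x B \<subseteq> N (code f)"
      using conjN[of "code f" k] conjN[of "code f'" k] k(1) same eq unfolding x_def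
      by (auto split: if_splits)
    have sgx: "subgroup (conjugate_set G (inv x) (N (code f))) G"
      using subgroup_conjugate_set[OF sgN] x by simp
    \<comment> \<open>The maximal subgroup contains the conjugates of both \<open>A\<close> and \<open>B\<close> by \<open>x\<close>, thus
      its own conjugate by the inverse of \<open>x\<close> contains the generating set.\<close>
    have "A \<union> B \<subseteq> conjugate_set G (inv x) (N (code f))"
    proof
      fix y assume y: "y \<in> A \<union> B"
      have "y = inv x \<otimes> (x \<otimes> y \<otimes> inv x) \<otimes> inv (inv x)"
        using y AB x by (auto simp: m_assoc cancel_inv)
      moreover have "x \<otimes> y \<otimes> inv x \<in> N (code f)"
        using y conj_AB by (auto simp: conjugate_set_def)
      ultimately show "y \<in> conjugate_set G (inv x) (N (code f))"
        unfolding conjugate_set_def by (rule image_eqI)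
    qed
    then have all: "carrier G \<subseteq> conjugate_set G (inv x) (N (code f))"
      using generate_subgroup_incl[OF _ sgx, of "A \<union> B"] unfolding gen by blast
    have "carrier G \<subseteq> N (code f)"
    proof
      fix y assume y: "y \<in> carrier G"
      then have "inv x \<otimes> y \<otimes> x \<in> conjugate_set G (inv x) (N (code f))" using x by (intro subsetD[OF all]) simp
      then obtain z where z: "z \<in> N (code f)" "inv x \<otimes> y \<otimes> x = inv x \<otimes> z \<otimes> x"
        using x by (auto simp: conjugate_set_def)
      moreover have "z \<in> carrier G" by (rule subgroup.mem_carrier[OF sgN z(1)])
      ultimately show "y \<in> N (code f)" using x y by (simp add: m_assoc)
    qed
    then show False using neN subgroup.subset[OF sgN] by blast
  qed
  moreover have "infinite_index (N (code f)) G" for f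
    unfolding infinite_index_def
  proof
    assume finidx: "finite (rcosets (N (code f)))"
    define q where "q = card (rcosets (N (code f)))"
    have gN: "g (chain (code f) k) k \<in> N (code f)" if "q \<le> k" for k
      unfolding g_def using pow_fact_mem_finite_index[OF sgN finidx] that t[OF chainP, of "fact k"]
      by (simp add: q_def)
    have sub: "(if code f k then A else B) \<subseteq> N (code f)" if "q \<le> k" for k
      using subset_if_conjugate_set_subset[OF sgN gN[OF that] _ conjN] AB by simp
    have "code f (2 * q) \<noteq> code f (2 * q + 1)" by (simp add: code_def)
    then show False using sub[of "2 * q"] sub[of "2 * q + 1"] not_both[of "code f"]
      by (auto split: if_splits)
  qed
  ultimately show ?thesis using N(1) by (intro exI[of _ "\<lambda>f. N (code f)"]) auto
qed

end

section \<open>Ping-pong for two subgroups modulo central elements\<close>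

context group
begin

text \<open>
The reduced words that begin with a letter of \<open>F\<close>, where only the last letter, taken from \<open>H\<close>,
may be central.
\<close>

inductive_set alternating :: "'a set \<Rightarrow> 'a set \<Rightarrow> 'a set \<Rightarrow> 'a set"
  for H F Z where
  single: "f \<in> F - Z \<Longrightarrow> h \<in> H \<Longrightarrow> f \<otimes> h \<in> alternating H F Z"
| longer: "f \<in> F - Z \<Longrightarrow> h \<in> H - Z \<Longrightarrow> w \<in> alternating H F Z \<Longrightarrow> f \<otimes> (h \<otimes> w) \<in> alternating H F Z"

lemma alternating_mem_carrier:
  assumes "w \<in> alternating H F Z" "H \<subseteq> carrier G" "F \<subseteq> carrier G"
  shows "w \<in> carrier G"
  using assms by (induction rule: alternating.induct) auto

text \<open>
The set of normal forms on the right is closed under left multiplication by \<open>H\<close> and by \<open>F\<close>: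
a letter that becomes central can be moved next to the following letter from \<open>H\<close> and absorbed.
\<close>

lemma generate_Un_alternating:
  assumes H: "subgroup H G" and F: "subgroup F G" and Z: "subgroup Z G" and ZH: "Z \<subseteq> H"
    and central: "\<And>z g. z \<in> Z \<Longrightarrow> g \<in> carrier G \<Longrightarrow> z \<otimes> g = g \<otimes> z"
    and g: "g \<in> generate G (H \<union> F)"
  shows "g \<in> H \<or> (\<exists>h\<in>H. \<exists>w\<in>alternating H F Z. g = h \<otimes> w)"
proof -
  let ?W = "alternating H F Z"
  let ?N = "H \<union> {h \<otimes> w |h w. h \<in> H \<and> w \<in> ?W}"
  have c: "h \<in> H \<Longrightarrow> h \<in> carrier G" "f \<in> F \<Longrightarrow> f \<in> carrier G" "w \<in> ?W \<Longrightarrow> w \<in> carrier G" for h f w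
    using H F subgroup.subset alternating_mem_carrier[of w H F Z] by blast+
  have N: "h \<in> H \<Longrightarrow> h \<in> ?N" "h \<in> H \<Longrightarrow> w \<in> ?W \<Longrightarrow> h \<otimes> w \<in> ?N" for h w by blast+
  have Nc: "x \<in> carrier G" if "x \<in> ?N" for x
    using that c by (elim UnE) auto
  have W: "w \<in> ?N" if "w \<in> ?W" for w
    using N(2)[OF subgroup.one_closed[OF H] that] c(3)[OF that] by simp
  have Hcl: "h \<otimes> x \<in> ?N" if "h \<in> H" "x \<in> ?N" for h x
  proof -
    have "h \<otimes> (h' \<otimes> w) \<in> ?N" if "h' \<in> H" "w \<in> ?W" for h' w
      using N(2)[of "h \<otimes> h'" w] that \<open>h \<in> H\<close> c H by (simp add: m_assoc subgroup.m_closed)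
    then show ?thesis using that H by (auto simp: subgroup.m_closed)
  qed
  have FW: "f \<otimes> w \<in> ?N" if f: "f \<in> F" and w: "w \<in> ?W" for f w
    using w
  proof cases
    case (single f' h)
    have eq: "f \<otimes> w = (f \<otimes> f') \<otimes> h" using single f c by (simp add: m_assoc)
    have ff: "f \<otimes> f' \<in> F" using single f F subgroup.m_closed by fast
    show ?thesis
    proof (cases "f \<otimes> f' \<in> Z")
      case True
      then show ?thesis unfolding eq using N(1) subgroup.m_closed[OF H] single ZH by blast
    next
      case False
      then have "(f \<otimes> f') \<otimes> h \<in> ?W" using ff single alternating.single by blast
      then show ?thesis unfolding eq using W by blast
    qed
  next
    case (longer f' h w')
    have eq: "f \<otimes> w = (f \<otimes> f') \<otimes> (h \<otimes> w')" using longer f c by (simp add: m_assoc)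
    have ff: "f \<otimes> f' \<in> F" using longer f F subgroup.m_closed by fast
    show ?thesis
    proof (cases "f \<otimes> f' \<in> Z")
      case True
      then show ?thesis unfolding eq using longer ZH Hcl[of "f \<otimes> f'" "h \<otimes> w'"] N(2) by blast
    next
      case False
      then have "(f \<otimes> f') \<otimes> (h \<otimes> w') \<in> ?W" using ff longer alternating.longer by blast
      then show ?thesis unfolding eq using W by blast
    qed
  qed
  have Fcl: "f \<otimes> x \<in> ?N" if f: "f \<in> F" and x: "x \<in> ?N" for f x
  proof (cases "f \<in> Z")
    case True then show ?thesis using Hcl x ZH by blast
  next
    case fZ: False
    consider "x \<in> H" | h w where "h \<in> H" "w \<in> ?W" "x = h \<otimes> w" using x by blast
    then show ?thesis
    proof cases
      case 1
      then have "f \<otimes> x \<in> ?W" using alternating.single fZ f by blast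
      then show ?thesis using W by blast
    next
      case (2 h w)
      show ?thesis
      proof (cases "h \<in> Z")
        case True
        have "f \<otimes> x = h \<otimes> (f \<otimes> w)"
          using 2 f c central[OF True, of f] by (simp add: m_assoc[symmetric])
        then show ?thesis using Hcl FW f 2 by simp
      next
        case False
        then have "f \<otimes> x \<in> ?W" using alternating.longer fZ f 2 by blast
        then show ?thesis using W by blast
      qed
    qed
  qed
  have "g \<in> carrier G \<and> (\<forall>x\<in>?N. g \<otimes> x \<in> ?N)" using g
  proof (induction rule: generate.induct)
    case one
    show ?case using Nc by simp
  next
    case (incl h)
    then show ?case using Hcl[of h] Fcl[of h] c(1,2)[of h] by (elim UnE) simp_all
  next
    case (inv h)
    then have "inv h \<in> H \<or> inv h \<in> F"
      using subgroup.m_inv_closed[OF H] subgroup.m_inv_closed[OF F] by auto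
    then show ?case using Hcl[of "inv h"] Fcl[of "inv h"] c(1,2)[of "inv h"]
      by (elim disjE) simp_all
  next
    case (eng h1 h2)
    have "h1 \<otimes> h2 \<otimes> x \<in> ?N" if "x \<in> ?N" for x
    proof -
      have "x \<in> carrier G" by (rule Nc[OF that])
      then have "h1 \<otimes> h2 \<otimes> x = h1 \<otimes> (h2 \<otimes> x)" using eng(3,4) by (simp add: m_assoc)
      moreover have "h1 \<otimes> (h2 \<otimes> x) \<in> ?N"
        using bspec[OF conjunct2[OF eng(3)] bspec[OF conjunct2[OF eng(4)] that]] .
      ultimately show ?thesis by simp
    qed
    then show ?case using eng(3,4) by simp
  qed
  then have "g \<otimes> \<one> \<in> ?N" "g \<in> carrier G" using N(1)[OF subgroup.one_closed[OF H]] by blast+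
  then show ?thesis by auto
qed

text \<open>
Reading a reduced word from the right, it takes \<open>Y\<close> to \<open>T\<close>, then to \<open>S\<close>, back to \<open>T\<close>,
and so on, and ends in \<open>S\<close>, apart from one last factor from \<open>H\<close>.
\<close>

lemma ping_pong:
  fixes act :: "'a \<Rightarrow> 'x \<Rightarrow> 'x"
  assumes H: "subgroup H G" and F: "subgroup F G" and Z: "subgroup Z G" and ZH: "Z \<subseteq> H"
    and central: "\<And>z g. z \<in> Z \<Longrightarrow> g \<in> carrier G \<Longrightarrow> z \<otimes> g = g \<otimes> z"
    and act: "\<And>g h x. g \<in> carrier G \<Longrightarrow> h \<in> carrier G \<Longrightarrow> act (g \<otimes> h) x = act g (act h x)"
    and HS: "\<And>h x. h \<in> H - Z \<Longrightarrow> x \<in> S \<Longrightarrow> act h x \<in> T"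
    and FT: "\<And>f x. f \<in> F - Z \<Longrightarrow> x \<in> T \<Longrightarrow> act f x \<in> S"
    and HY: "\<And>h y. h \<in> H \<Longrightarrow> y \<in> Y \<Longrightarrow> act h y \<in> T"
    and g: "g \<in> generate G (H \<union> F)" and gH: "g \<notin> H"
  shows "\<exists>h\<in>H. \<forall>y\<in>Y. \<exists>x\<in>S. act g y = act h x"
proof -
  have c: "h \<in> H \<Longrightarrow> h \<in> carrier G" "f \<in> F \<Longrightarrow> f \<in> carrier G"
    "w \<in> alternating H F Z \<Longrightarrow> w \<in> carrier G" for h f w
    using H F subgroup.subset alternating_mem_carrier[of w H F Z] by blast+
  have "\<forall>y\<in>Y. act w y \<in> S" if "w \<in> alternating H F Z" for w
    using that
  proof (induction rule: alternating.induct)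
    case (single f h)
    then show ?case using act c FT HY by simp
  next
    case (longer f h w)
    then show ?case using act c FT HS by simp
  qed
  moreover obtain h w where "h \<in> H" "w \<in> alternating H F Z" "g = h \<otimes> w"
    using generate_Un_alternating[OF H F Z ZH central g] gH by blast
  ultimately show ?thesis using act c by blast
qed

end

section \<open>Generation of SL(n, Z) by two finite subgroups\<close>

lemma carrier_SLZ_iff: "g \<in> carrier (SLZ n) \<longleftrightarrow> g \<in> carrier_mat n n \<and> det g = 1"
  by (simp add: SLZ_def)

lemma mult_SLZ [simp]: "g \<otimes>\<^bsub>SLZ n\<^esub> h = g * h"
  by (simp add: SLZ_def)

lemma one_SLZ [simp]: "\<one>\<^bsub>SLZ n\<^esub> = 1\<^sub>m n"
  by (simp add: SLZ_def)

lemma inv_SLZ_eqI: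
  assumes "g \<in> carrier (SLZ n)" "h \<in> carrier (SLZ n)" "h * g = 1\<^sub>m n"
  shows "inv\<^bsub>SLZ n\<^esub> g = h"
  by (rule group.inv_equality[OF group_SLZ]) (use assms in simp_all)

lemma addrow_mat_mem_SLZ:
  assumes "k \<noteq> l"
  shows "addrow_mat n a k l \<in> carrier (SLZ n)"
  using assms by (simp add: carrier_SLZ_iff det_addrow_mat)

definition unit_columns :: "nat \<Rightarrow> nat \<Rightarrow> int mat \<Rightarrow> bool" where
  "unit_columns n k g \<longleftrightarrow> (\<forall>j<k. \<forall>i<n. g $$ (i, j) = (if i = j then 1 else 0))"

lemma unit_columns_addrow:
  assumes "g \<in> carrier_mat n n" "unit_columns n k g" "k \<le> l" "l < n" "k \<le> n"
  shows "unit_columns n k (addrow a p l g)"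
  using assms by (auto simp: unit_columns_def)

text \<open>
Row \<open>k\<close> of the inverse matrix vanishes left of the diagonal, because the first columns are unit
vectors; its product with column \<open>k\<close> reduces to a single term and equals 1.
\<close>

lemma pivot_square_eq_1:
  assumes g: "g \<in> carrier (SLZ n)" and k: "k < n" and u: "unit_columns n k g"
    and p: "k \<le> p" "p < n" and only: "\<And>i. k \<le> i \<Longrightarrow> i < n \<Longrightarrow> i \<noteq> p \<Longrightarrow> g $$ (i, k) = 0"
  shows "g $$ (p, k) * g $$ (p, k) = 1"
proof -
  interpret group "SLZ n" by (rule group_SLZ)
  define h where "h = inv\<^bsub>SLZ n\<^esub> g"
  have h: "h \<in> carrier (SLZ n)" "h * g = 1\<^sub>m n"
    unfolding h_def using g l_inv[OF g] by auto
  have gc: "g \<in> carrier_mat n n" "h \<in> carrier_mat n n" using g h by (auto simp: carrier_SLZ_iff)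
  have entry: "(\<Sum>i<n. h $$ (k, i) * g $$ (i, j)) = (if k = j then 1 else 0)" if "j < n" for j
  proof -
    have "(h * g) $$ (k, j) = (\<Sum>i<n. h $$ (k, i) * g $$ (i, j))"
      using gc k that by (auto simp: scalar_prod_def atLeast0LessThan intro!: sum.cong)
    then show ?thesis using h(2) k that by simp
  qed
  have hk: "h $$ (k, j) = 0" if "j < k" for j
  proof -
    have "(\<Sum>i<n. h $$ (k, i) * g $$ (i, j)) = (\<Sum>i<n. if i = j then h $$ (k, i) else 0)"
      using u that by (intro sum.cong) (auto simp: unit_columns_def)
    also have "\<dots> = h $$ (k, j)" using that k by simp
    finally show ?thesis using entry[of j] that k by simp
  qed
  have "(\<Sum>i<n. h $$ (k, i) * g $$ (i, k)) = (\<Sum>i<n. if i = p then h $$ (k, i) * g $$ (i, k) else 0)"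
    using hk only by (intro sum.cong) (auto simp: not_less[symmetric])
  also have "\<dots> = h $$ (k, p) * g $$ (p, k)" using p by simp
  finally have "h $$ (k, p) * g $$ (p, k) = 1" using entry[OF k] by simp
  then have "g $$ (p, k) = 1 \<or> g $$ (p, k) = -1" using zmult_eq_1_iff[of "h $$ (k, p)" "g $$ (p, k)"] by auto
  then show ?thesis by auto
qed

text \<open>
Gaussian elimination by row operations shows that a subgroup with all elementary matrices is the
whole group.
\<close>

locale elementary_closed =
  fixes n :: nat and K :: "int mat set"
  assumes K: "subgroup K (SLZ n)"
    and elementary: "\<And>a k l. k < n \<Longrightarrow> l < n \<Longrightarrow> k \<noteq> l \<Longrightarrow> addrow_mat n a k l \<in> K"
begin

definition reach :: "int mat \<Rightarrow> int mat \<Rightarrow> bool" where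
  "reach g g' \<longleftrightarrow> (\<exists>e\<in>K. g' = e * g) \<and> g' \<in> carrier (SLZ n)"

lemma reach_refl: "g \<in> carrier (SLZ n) \<Longrightarrow> reach g g"
  using subgroup.one_closed[OF K] by (auto simp: reach_def carrier_SLZ_iff intro!: bexI[of _ "1\<^sub>m n"])

lemma reach_trans:
  assumes "g \<in> carrier (SLZ n)" "reach g g'" "reach g' g''"
  shows "reach g g''"
proof -
  obtain e e' where e: "e \<in> K" "g' = e * g" "e' \<in> K" "g'' = e' * g'"
    using assms by (auto simp: reach_def)
  have "e' * e \<in> K" using subgroup.m_closed[OF K e(3,1)] by simp
  moreover have "g'' = e' * e * g"
    using e subgroup.mem_carrier[OF K] assms(1)
    by (auto simp: carrier_SLZ_iff assoc_mult_mat[of _ n n _ n _ n])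
  ultimately show ?thesis using assms(3) by (auto simp: reach_def)
qed

lemma reach_addrow:
  assumes g: "g \<in> carrier (SLZ n)" and kl: "k < n" "l < n" "k \<noteq> l"
  shows "reach g (addrow a k l g)"
proof -
  have eq: "addrow a k l g = addrow_mat n a k l * g"
    using g kl by (intro addrow_mat[of _ _ n]) (auto simp: carrier_SLZ_iff)
  have "addrow_mat n a k l * g \<in> carrier (SLZ n)"
    using monoid.m_closed[OF group.is_monoid[OF group_SLZ] addrow_mat_mem_SLZ[OF kl(3)] g] by simp
  then show ?thesis unfolding reach_def eq using elementary[OF kl] by blast
qed

lemma reach_mem: "reach g g' \<Longrightarrow> g' \<in> carrier (SLZ n)"
  by (simp add: reach_def)

text \<open>
The Euclidean algorithm: as long as two entries on or below the diagonal are nonzero, the larger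
one can be diminished by the smaller one, which decreases the sum of the absolute values.
\<close>

lemma euclid_column:
  assumes "g \<in> carrier (SLZ n)" "k < n" "unit_columns n k g"
  shows "\<exists>g' p. reach g g' \<and> unit_columns n k g' \<and> k \<le> p \<and> p < n \<and>
    (\<forall>i. k \<le> i \<longrightarrow> i < n \<longrightarrow> i \<noteq> p \<longrightarrow> g' $$ (i, k) = 0)"
  using assms
proof (induction "\<Sum>i\<in>{k..<n}. nat \<bar>g $$ (i, k)\<bar>" arbitrary: g rule: less_induct)
  case less
  have gc: "g \<in> carrier_mat n n" using less.prems by (simp add: carrier_SLZ_iff)
  show ?case
  proof (cases "\<exists>p l. k \<le> p \<and> p < n \<and> k \<le> l \<and> l < n \<and> p \<noteq> l \<and> g $$ (p, k) \<noteq> 0 \<and> g $$ (l, k) \<noteq> 0")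
    case True
    then obtain p l where pl: "k \<le> p" "p < n" "k \<le> l" "l < n" "p \<noteq> l" "g $$ (l, k) \<noteq> 0"
      "\<bar>g $$ (l, k)\<bar> \<le> \<bar>g $$ (p, k)\<bar>"
      by (metis linorder_le_cases)
    define a where "a = - sgn (g $$ (p, k)) * sgn (g $$ (l, k))"
    define g' where "g' = addrow a p l g"
    have ent: "g' $$ (i, k) = (if i = p then a * g $$ (l, k) + g $$ (p, k) else g $$ (i, k))" if "i < n" for i
      using that gc less.prems pl by (auto simp: g'_def)
    have small: "nat \<bar>g' $$ (p, k)\<bar> < nat \<bar>g $$ (p, k)\<bar>"
      using pl ent[of p] unfolding a_def by (auto simp: sgn_if split: if_splits)
    have "(\<Sum>i\<in>{k..<n}. nat \<bar>g' $$ (i, k)\<bar>) < (\<Sum>i\<in>{k..<n}. nat \<bar>g $$ (i, k)\<bar>)"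
    proof (rule sum_strict_mono_ex1)
      show "\<forall>i\<in>{k..<n}. nat \<bar>g' $$ (i, k)\<bar> \<le> nat \<bar>g $$ (i, k)\<bar>"
      proof
        fix i assume i: "i \<in> {k..<n}"
        show "nat \<bar>g' $$ (i, k)\<bar> \<le> nat \<bar>g $$ (i, k)\<bar>"
        proof (cases "i = p")
          case True then show ?thesis using less_imp_le[OF small] by blast
        next
          case False then show ?thesis using ent[of i] i by simp
        qed
      qed
      show "\<exists>i\<in>{k..<n}. nat \<bar>g' $$ (i, k)\<bar> < nat \<bar>g $$ (i, k)\<bar>"
        using small pl by (intro bexI[of _ p]) auto
    qed simp
    moreover have r: "reach g g'" unfolding g'_def using less.prems pl by (intro reach_addrow) auto
    moreover have "unit_columns n k g'"
      unfolding g'_def using gc less.prems pl by (intro unit_columns_addrow) auto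
    ultimately obtain g'' q where "reach g' g''" "unit_columns n k g''" "k \<le> q" "q < n"
      "\<forall>i. k \<le> i \<longrightarrow> i < n \<longrightarrow> i \<noteq> q \<longrightarrow> g'' $$ (i, k) = 0"
      using less.hyps[of g'] less.prems(2) reach_mem[OF r] by blast
    then show ?thesis using reach_trans[OF less.prems(1) r] by blast
  next
    case False
    show ?thesis
    proof (cases "\<exists>p. k \<le> p \<and> p < n \<and> g $$ (p, k) \<noteq> 0")
      case True
      then show ?thesis using False reach_refl[OF less.prems(1)] less.prems(3) by blast
    next
      case False
      then show ?thesis using reach_refl[OF less.prems(1)] less.prems(2,3) by blast
    qed
  qed
qed

text \<open>
The surviving entry is a unit. If there is another row below the pivot, a wrong sign can be mended
with its help; in the last column the matrix is triangular and the determinant forces the entry to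
be 1.
\<close>

lemma pivot_to_1:
  assumes g: "g \<in> carrier (SLZ n)" and k: "k < n" and u: "unit_columns n k g"
  shows "\<exists>g'. reach g g' \<and> unit_columns n k g' \<and> g' $$ (k, k) = 1"
proof -
  obtain h p where h: "reach g h" "unit_columns n k h" "k \<le> p" "p < n"
    and only: "\<And>i. k \<le> i \<Longrightarrow> i < n \<Longrightarrow> i \<noteq> p \<Longrightarrow> h $$ (i, k) = 0"
    using euclid_column[OF assms] by blast
  have hS: "h \<in> carrier (SLZ n)" using reach_mem[OF h(1)] .
  then have hc: "h \<in> carrier_mat n n" by (simp add: carrier_SLZ_iff)
  define c where "c = h $$ (p, k)"
  have cc: "c * c = 1" unfolding c_def using pivot_square_eq_1[OF hS k h(2,3,4) only] .
  consider (one) "p \<noteq> k" | (two) "p = k" "Suc k < n" | (last) "p = k" "n = Suc k" using k by linarith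
  then show ?thesis
  proof cases
    case one
    have "reach h (addrow c k p h)" "unit_columns n k (addrow c k p h)"
      using reach_addrow[OF hS, of k p] unit_columns_addrow[OF hc h(2,3,4)] h k one by auto
    moreover have "addrow c k p h $$ (k, k) = 1"
      using hc h k one only[of k] cc by (simp add: c_def)
    ultimately show ?thesis using reach_trans[OF g h(1)] by blast
  next
    case two
    \<comment> \<open>A copy of the pivot \<open>c\<close> in the row below allows adding \<open>c (1 - c) c = 1 - c\<close> to it.\<close>
    define h1 where "h1 = addrow 1 (Suc k) k h"
    define h2 where "h2 = addrow (c * (1 - c)) k (Suc k) h1"
    have h1: "reach h h1" "unit_columns n k h1"
      unfolding h1_def using reach_addrow[OF hS, of "Suc k" k] unit_columns_addrow[OF hc h(2)] k two by auto
    have h1c: "h1 \<in> carrier_mat n n" unfolding h1_def using hc by simp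
    have h2: "reach h1 h2" "unit_columns n k h2"
      unfolding h2_def using reach_addrow[OF reach_mem[OF h1(1)], of k "Suc k"]
        unit_columns_addrow[OF h1c h1(2)] two by auto
    have "h1 $$ (k, k) = c" "h1 $$ (Suc k, k) = c"
      using hc k two only[of "Suc k"] by (auto simp: h1_def c_def)
    then have "h2 $$ (k, k) = c * (1 - c) * c + c" using h1c k two by (simp add: h2_def)
    also have "\<dots> = c * c - c * c * c + c" by (simp add: algebra_simps)
    also have "\<dots> = 1" using cc by simp
    finally show ?thesis
      using h2 reach_trans[OF g h(1) reach_trans[OF hS h1(1) h2(1)]] by blast
  next
    case last
    have "upper_triangular h"
      using hc h(2) last by (auto simp: upper_triangular_def unit_columns_def)
    then have "det h = prod_list (diag_mat h)" using hc det_upper_triangular by blast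
    also have "diag_mat h = map (\<lambda>i. h $$ (i, i)) [0..<k] @ [h $$ (k, k)]"
      using hc last by (simp add: diag_mat_def)
    also have "map (\<lambda>i. h $$ (i, i)) [0..<k] = map (\<lambda>i. 1) [0..<k]"
      using h(2) k by (auto simp: unit_columns_def)
    also have "prod_list (map (\<lambda>i. 1) [0..<k] @ [h $$ (k, k)]) = h $$ (k, k)"
      by (simp add: prod_list.append map_replicate_const)
    finally have "h $$ (k, k) = 1" using hS by (simp add: carrier_SLZ_iff)
    then show ?thesis using h by blast
  qed
qed

lemma clear_column:
  assumes g: "g \<in> carrier (SLZ n)" and k: "k < n" and u: "unit_columns n k g" "g $$ (k, k) = 1"
    and I: "finite I" "I \<subseteq> {..<n} - {k}"
  shows "\<exists>g'. reach g g' \<and> unit_columns n k g' \<and> g' $$ (k, k) = 1 \<and> (\<forall>i\<in>I. g' $$ (i, k) = 0)"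
  using I
proof (induction I rule: finite_induct)
  case empty
  then show ?case using reach_refl[OF g] u by blast
next
  case (insert i I)
  then obtain h where h: "reach g h" "unit_columns n k h" "h $$ (k, k) = 1" "\<forall>i\<in>I. h $$ (i, k) = 0"
    by auto
  have hS: "h \<in> carrier (SLZ n)" using reach_mem[OF h(1)] .
  then have hc: "h \<in> carrier_mat n n" by (simp add: carrier_SLZ_iff)
  define h' where "h' = addrow (- h $$ (i, k)) i k h"
  have "reach h h'" "unit_columns n k h'"
    unfolding h'_def using reach_addrow[OF hS, of i k] unit_columns_addrow[OF hc h(2)] insert.prems k by auto
  moreover have ent: "h' $$ (j, k) = (if j = i then 0 else h $$ (j, k))" if "j < n" for j
    using hc that k h(3) by (auto simp: h'_def)
  moreover have "h' $$ (k, k) = 1" using ent[OF k] insert.prems h(3) by auto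
  moreover have "\<forall>j\<in>insert i I. h' $$ (j, k) = 0"
  proof
    fix j assume j: "j \<in> insert i I"
    then have "j < n" using insert.prems by auto
    then show "h' $$ (j, k) = 0" using ent[of j] j h(4) by auto
  qed
  ultimately show ?case using reach_trans[OF g h(1)] by blast
qed

lemma reach_unit_columns:
  assumes g: "g \<in> carrier (SLZ n)" and "k \<le> n"
  shows "\<exists>g'. reach g g' \<and> unit_columns n k g'"
  using assms(2)
proof (induction k)
  case 0
  then show ?case using reach_refl[OF g] by (auto simp: unit_columns_def)
next
  case (Suc k)
  then obtain h where h: "reach g h" "unit_columns n k h" by auto
  have k: "k < n" using Suc by simp
  obtain h1 where h1: "reach h h1" "unit_columns n k h1" "h1 $$ (k, k) = 1"
    using pivot_to_1[OF reach_mem[OF h(1)] k h(2)] by blast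
  obtain h2 where h2: "reach h1 h2" "unit_columns n k h2" "h2 $$ (k, k) = 1"
    "\<forall>i\<in>{..<n} - {k}. h2 $$ (i, k) = 0"
    using clear_column[OF reach_mem[OF h1(1)] k h1(2,3), of "{..<n} - {k}"] by blast
  have "unit_columns n (Suc k) h2"
    using h2 k by (auto simp: unit_columns_def less_Suc_eq)
  moreover have "reach g h2"
    using reach_trans[OF g h(1)] reach_trans[OF reach_mem[OF h(1)] h1(1) h2(1)] by blast
  ultimately show ?case by blast
qed

lemma carrier_subset: "carrier (SLZ n) \<subseteq> K"
proof
  interpret group "SLZ n" by (rule group_SLZ)
  fix g assume g: "g \<in> carrier (SLZ n)"
  obtain g' where g': "reach g g'" "unit_columns n n g'" using reach_unit_columns[OF g] by blast
  have "g' = 1\<^sub>m n"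
    using g' by (intro eq_matI) (auto simp: unit_columns_def reach_def carrier_SLZ_iff)
  then obtain e where e: "e \<in> K" "e * g = 1\<^sub>m n" using g'(1) by (auto simp: reach_def)
  have ec: "e \<in> carrier (SLZ n)" by (rule subgroup.mem_carrier[OF K e(1)])
  have "inv\<^bsub>SLZ n\<^esub> g = e" using inv_SLZ_eqI[OF g ec e(2)] .
  then have "g = inv\<^bsub>SLZ n\<^esub> e" using g by (metis inv_inv)
  then show "g \<in> K" using subgroup.m_inv_closed[OF K e(1)] by simp
qed

end

text \<open>
Integral orthogonal matrices have exactly one nonzero entry, a sign, in each row and column, hence
the name; the orthogonality relation makes the group laws immediate and bounds the entries.
\<close>

definition signed_permutations :: "nat \<Rightarrow> int mat set" where
  "signed_permutations n = {g \<in> carrier (SLZ n). g * transpose_mat g = 1\<^sub>m n}"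

lemma signed_permutations_mult:
  assumes gc: "g \<in> carrier_mat n n" "h \<in> carrier_mat n n" and det: "det g * det h = 1"
    and g: "g * transpose_mat g = 1\<^sub>m n" and h: "h * transpose_mat h = 1\<^sub>m n"
  shows "g * h \<in> signed_permutations n"
proof -
  have "(g * h) * transpose_mat (g * h) = g * (h * transpose_mat h) * transpose_mat g"
    using gc by (simp add: transpose_mult[of _ n n _ n] assoc_mult_mat[of _ n n _ n _ n])
  also have "\<dots> = 1\<^sub>m n" using gc g h by simp
  finally show ?thesis
    using gc det by (simp add: signed_permutations_def carrier_SLZ_iff det_mult)
qed

lemma subgroup_signed_permutations: "subgroup (signed_permutations n) (SLZ n)"
proof -
  interpret group "SLZ n" by (rule group_SLZ)
  have inv: "inv\<^bsub>SLZ n\<^esub> g = transpose_mat g" "transpose_mat g \<in> carrier (SLZ n)"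
    "transpose_mat g * g = 1\<^sub>m n"
    if "g \<in> signed_permutations n" for g
  proof -
    have g: "g \<in> carrier (SLZ n)" "g * transpose_mat g = 1\<^sub>m n"
      using that by (auto simp: signed_permutations_def)
    show tc: "transpose_mat g \<in> carrier (SLZ n)" using g by (auto simp: carrier_SLZ_iff det_transpose)
    show "inv\<^bsub>SLZ n\<^esub> g = transpose_mat g"
      using inv_equality[of g "transpose_mat g"] g tc by (metis inv_inv mult_SLZ one_SLZ)
    then show "transpose_mat g * g = 1\<^sub>m n" using l_inv[OF g(1)] by simp
  qed
  show ?thesis
  proof (rule subgroupI)
    show "signed_permutations n \<subseteq> carrier (SLZ n)" by (auto simp: signed_permutations_def)
    have "1\<^sub>m n \<in> signed_permutations n"
      by (auto simp: signed_permutations_def carrier_SLZ_iff)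
    then show "signed_permutations n \<noteq> {}" by blast
    show "inv\<^bsub>SLZ n\<^esub> g \<in> signed_permutations n" if "g \<in> signed_permutations n" for g
      using inv[OF that] by (auto simp: signed_permutations_def)
    fix g h assume gh: "g \<in> signed_permutations n" "h \<in> signed_permutations n"
    then have c: "g \<in> carrier_mat n n" "h \<in> carrier_mat n n"
      and e: "g * transpose_mat g = 1\<^sub>m n" "h * transpose_mat h = 1\<^sub>m n"
      by (auto simp: signed_permutations_def carrier_SLZ_iff)
    moreover have "det g * det h = 1"
      using gh by (simp add: signed_permutations_def carrier_SLZ_iff)
    ultimately show "g \<otimes>\<^bsub>SLZ n\<^esub> h \<in> signed_permutations n"
      using signed_permutations_mult by simp
  qed
qed

lemma finite_bounded_int_matrices: "finite {g \<in> carrier_mat n n. \<forall>i<n. \<forall>j<n. \<bar>g $$ (i, j)\<bar> \<le> (b::int)}"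
proof -
  have "finite (PiE ({..<n} \<times> {..<n}) (\<lambda>_. {-b..b}))" by (intro finite_PiE) auto
  moreover have "{g \<in> carrier_mat n n. \<forall>i<n. \<forall>j<n. \<bar>g $$ (i, j)\<bar> \<le> b} \<subseteq>
      mat n n ` PiE ({..<n} \<times> {..<n}) (\<lambda>_. {-b..b})"
  proof
    fix g assume "g \<in> {g \<in> carrier_mat n n. \<forall>i<n. \<forall>j<n. \<bar>g $$ (i, j)\<bar> \<le> b}"
    then have g: "g \<in> carrier_mat n n" "\<And>i j. i < n \<Longrightarrow> j < n \<Longrightarrow> \<bar>g $$ (i, j)\<bar> \<le> b" by auto
    have "g = mat n n (restrict (\<lambda>p. g $$ p) ({..<n} \<times> {..<n}))"
      using g(1) by (intro eq_matI) auto
    moreover have "restrict (\<lambda>p. g $$ p) ({..<n} \<times> {..<n}) \<in> PiE ({..<n} \<times> {..<n}) (\<lambda>_. {-b..b})"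
      using g(2) by (auto simp: abs_le_iff minus_le_iff)
    ultimately show "g \<in> mat n n ` PiE ({..<n} \<times> {..<n}) (\<lambda>_. {-b..b})" by blast
  qed
  ultimately show ?thesis using finite_surj by blast
qed

lemma finite_signed_permutations: "finite (signed_permutations n)"
proof (rule finite_subset[OF _ finite_bounded_int_matrices])
  show "signed_permutations n \<subseteq> {g \<in> carrier_mat n n. \<forall>i<n. \<forall>j<n. \<bar>g $$ (i, j)\<bar> \<le> 1}"
  proof (clarsimp, intro conjI allI impI)
    fix g assume g: "g \<in> signed_permutations n"
    then show gc: "g \<in> carrier_mat n n" by (auto simp: signed_permutations_def carrier_SLZ_iff)
    fix i j assume ij: "i < n" "j < n"
    have "(g * transpose_mat g) $$ (i, i) = (\<Sum>k<n. g $$ (i, k) * g $$ (i, k))"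
      using gc ij by (auto simp: scalar_prod_def atLeast0LessThan)
    then have "(\<Sum>k<n. g $$ (i, k) * g $$ (i, k)) = 1"
      using g ij by (auto simp: signed_permutations_def)
    moreover have "g $$ (i, j) * g $$ (i, j) \<le> (\<Sum>k<n. g $$ (i, k) * g $$ (i, k))"
      using ij by (intro member_le_sum) auto
    ultimately have "(g $$ (i, j))\<^sup>2 \<le> 1" by (simp add: power2_eq_square)
    then show "\<bar>g $$ (i, j)\<bar> \<le> 1" by (simp add: abs_square_le_1)
  qed
qed


lemma addrow_mat_add:
  assumes "k < n" "l < n" "k \<noteq> l"
  shows "addrow_mat n a k l * addrow_mat n b k l = addrow_mat n (a + b :: int) k l"
proof -
  have "addrow_mat n a k l * addrow_mat n b k l = addrow a k l (addrow_mat n b k l)"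
    using assms by (intro addrow_mat[of _ _ n, symmetric]) auto
  also have "\<dots> = addrow_mat n (a + b) k l"
    using assms by (intro eq_matI) auto
  finally show ?thesis .
qed

lemma multrow_minus_1_square: "multrow_mat n i (- 1) * multrow_mat n i (- 1) = (1\<^sub>m n :: int mat)"
proof -
  have "multrow_mat n i (- 1) * multrow_mat n i (- 1 :: int) = multrow i (- 1) (multrow_mat n i (- 1))"
    by (intro multrow_mat[of _ _ n, symmetric]) auto
  also have "\<dots> = 1\<^sub>m n" by (intro eq_matI) auto
  finally show ?thesis .
qed

lemma multrow_minus_1_orthogonal:
  "multrow_mat n i (- 1) * transpose_mat (multrow_mat n i (- 1)) = (1\<^sub>m n :: int mat)"
proof -
  have "transpose_mat (multrow_mat n i (- 1)) = (multrow_mat n i (- 1) :: int mat)"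
    by (intro eq_matI) auto
  then show ?thesis by (simp add: multrow_minus_1_square)
qed

lemma swaprows_orthogonal:
  assumes "i < n" "j < n"
  shows "swaprows_mat n i j * transpose_mat (swaprows_mat n i j) = (1\<^sub>m n :: int mat)"
proof -
  have "transpose_mat (swaprows_mat n i j) = (swaprows_mat n i j :: int mat)"
    by (intro eq_matI) auto
  then show ?thesis using swaprows_mat_inv[OF assms] by simp
qed

text \<open>
A transposition of two coordinates has determinant \<open>-1\<close>; one sign repairs this.
\<close>

definition signed_swap :: "nat \<Rightarrow> nat \<Rightarrow> nat \<Rightarrow> int mat" where
  "signed_swap n i j = multrow_mat n i (- 1) * swaprows_mat n i j"

lemma signed_swap_mem:
  assumes "i < n" "j < n" "i \<noteq> j"
  shows "signed_swap n i j \<in> signed_permutations n"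
  unfolding signed_swap_def
  using assms by (intro signed_permutations_mult multrow_minus_1_orthogonal swaprows_orthogonal)
    (auto simp: det_multrow_mat det_swaprows_mat)

text \<open>
Conjugation by these matrices permutes the elementary matrices up to sign, so a single one of them
yields all the others.
\<close>

lemma signed_swap_addrow_mat:
  assumes ij: "i < n" "j < n" "i \<noteq> j" and kl: "k < n" "l < n" "k \<noteq> l"
  defines "k' \<equiv> Transposition.transpose i j k" and "l' \<equiv> Transposition.transpose i j l"
  shows "\<exists>b. (b = a \<or> b = - a) \<and>
    signed_swap n i j * addrow_mat n a k l = addrow_mat n b k' l' * signed_swap n i j"
proof -
  define b where "b = (if k' = i then -1 else 1) * (if l' = i then -1 else 1) * a"
  have k': "k' < n" "l' < n" using assms by (auto simp: Transposition.transpose_def)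
  have ne: "k' \<noteq> l'" using kl(3) unfolding k'_def l'_def by (auto simp: Transposition.transpose_def)
  have W: "signed_swap n i j = multrow i (- 1) (swaprows_mat n i j)"
    unfolding signed_swap_def by (rule multrow_mat[of _ _ n, symmetric]) simp
  have "signed_swap n i j * addrow_mat n a k l =
      multrow_mat n i (- 1) * (swaprows_mat n i j * addrow_mat n a k l)"
    unfolding signed_swap_def by (rule assoc_mult_mat[of _ n n _ n _ n]) auto
  also have "swaprows_mat n i j * addrow_mat n a k l = swaprows i j (addrow_mat n a k l)"
    using ij by (intro swaprows_mat[of _ _ n, symmetric]) auto
  also have "multrow_mat n i (- 1) * \<dots> = multrow i (- 1) \<dots>"
    by (intro multrow_mat[of _ _ n, symmetric]) auto
  also have "swaprows i j (addrow_mat n a k l) = addrow a k' l' (swaprows_mat n i j)"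
  proof (rule eq_matI)
    fix r c assume "r < dim_row (addrow a k' l' (swaprows_mat n i j))"
      "c < dim_col (addrow a k' l' (swaprows_mat n i j))"
    then have rc: "r < n" "c < n" by auto
    have S: "swaprows_mat n i j $$ (p, c) = (if c = Transposition.transpose i j p then 1 else 0 :: int)"
      if "p < n" for p
      using that rc by (auto simp: Transposition.transpose_def)
    have "swaprows i j (addrow_mat n a k l) $$ (r, c) = addrow_mat n a k l $$ (Transposition.transpose i j r, c)"
      using rc ij by (auto simp: Transposition.transpose_def)
    moreover have "Transposition.transpose i j r < n"
      using rc ij by (auto simp: Transposition.transpose_def)
    moreover have "k' = r \<longleftrightarrow> k = Transposition.transpose i j r"
      unfolding k'_def by auto
    moreover have "Transposition.transpose i j l' = l" by (simp add: l'_def)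
    ultimately show "swaprows i j (addrow_mat n a k l) $$ (r, c) =
        addrow a k' l' (swaprows_mat n i j) $$ (r, c)"
      using rc k' S[of r] S[of l'] kl by auto
  qed auto
  also have "multrow i (- 1) \<dots> = addrow b k' l' (multrow i (- 1) (swaprows_mat n i j))"
    using k' ne unfolding b_def by (intro eq_matI) (simp_all add: algebra_simps)
  also have "\<dots> = addrow_mat n b k' l' * signed_swap n i j"
    unfolding W using k' by (intro addrow_mat[of _ _ n]) auto
  finally show ?thesis by (intro exI[of _ b]) (auto simp: b_def)
qed

text \<open>
An elementary matrix times the diagonal matrix with signs \<open>-1\<close> in the coordinates 1 and 2. The
latter inverts the elementary matrix under conjugation, so the product is an involution. The
coordinate 2 only serves to make the determinant 1; this is where three dimensions are needed.
\<close>

definition shear_reflection :: "nat \<Rightarrow> int mat" where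
  "shear_reflection n = addrow_mat n 1 0 1 * (multrow_mat n 1 (- 1) * multrow_mat n 2 (- 1))"

lemma
  assumes n: "n \<ge> 3"
  shows shear_reflection_mem: "shear_reflection n \<in> carrier (SLZ n)"
    and shear_reflection_square: "shear_reflection n * shear_reflection n = 1\<^sub>m n"
    and shear_reflection_factor: "\<exists>d\<in>signed_permutations n. shear_reflection n * d = addrow_mat n 1 0 1"
proof -
  define E where "E a = (addrow_mat n a 0 1 :: int mat)" for a
  define D where "D = (multrow_mat n 1 (- 1) * multrow_mat n 2 (- 1) :: int mat)"
  have s: "shear_reflection n = E 1 * D" by (simp add: shear_reflection_def E_def D_def)
  have c: "E a \<in> carrier_mat n n" "D \<in> carrier_mat n n" for a
    unfolding E_def D_def by (simp, intro mult_carrier_mat[of _ _ n]) simp_all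
  have Dp: "D \<in> signed_permutations n" unfolding D_def
    using n by (intro signed_permutations_mult multrow_minus_1_orthogonal) (auto simp: det_multrow_mat)
  have D: "D = multrow 1 (- 1) (multrow_mat n 2 (- 1))"
    unfolding D_def by (rule multrow_mat[of _ _ n, symmetric]) simp
  have DD: "D * D = 1\<^sub>m n"
  proof -
    have "transpose_mat D = D" unfolding D by (intro eq_matI) auto
    then show ?thesis using Dp by (auto simp: signed_permutations_def)
  qed
  have "D * E 1 = multrow_mat n 1 (- 1) * (multrow_mat n 2 (- 1) * E 1)"
    unfolding D_def E_def by (rule assoc_mult_mat[of _ n n _ n _ n]) auto
  also have "multrow_mat n 2 (- 1) * E 1 = multrow 2 (- 1) (E 1)"
    using c by (intro multrow_mat[of _ _ n, symmetric]) auto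
  also have "multrow_mat n 1 (- 1) * \<dots> = multrow 1 (- 1) \<dots>"
    using c by (intro multrow_mat[of _ _ n, symmetric]) auto
  also have "\<dots> = addrow (- 1) 0 1 D"
    unfolding E_def D using n by (intro eq_matI) auto
  also have "\<dots> = E (- 1) * D"
    unfolding E_def using n c by (intro addrow_mat[of _ _ n]) auto
  finally have DE: "D * E 1 = E (- 1) * D" .
  have EE: "E 1 * E (- 1) = 1\<^sub>m n"
    unfolding E_def using n addrow_mat_inv[of 0 n 1 1] by auto
  have ED: "E a * D \<in> carrier_mat n n" for a using c by (intro mult_carrier_mat[of _ _ n])
  have "E 1 * D * (E 1 * D) = E 1 * (D * E 1) * D"
    using c ED by (simp add: assoc_mult_mat[of _ n n _ n _ n])
  also have "\<dots> = E 1 * E (- 1) * (D * D)"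
    unfolding DE using c ED by (simp add: assoc_mult_mat[of _ n n _ n _ n])
  also have "\<dots> = 1\<^sub>m n" by (simp add: EE DD)
  finally show "shear_reflection n * shear_reflection n = 1\<^sub>m n" by (simp add: s)
  have "det (E 1 * D) = det (E 1) * det D" using c by (rule det_mult)
  moreover have "det (E 1) = 1" using addrow_mat_mem_SLZ[of 0 1 n 1] by (simp add: E_def carrier_SLZ_iff)
  moreover have "det D = 1" using Dp by (simp add: signed_permutations_def carrier_SLZ_iff)
  ultimately show "shear_reflection n \<in> carrier (SLZ n)"
    using ED[of 1] by (simp add: s carrier_SLZ_iff)
  have "shear_reflection n * D = E 1"
    using c DD right_mult_one_mat[OF c(1)] by (simp add: s assoc_mult_mat[of _ n n _ n _ n])
  then show "\<exists>d\<in>signed_permutations n. shear_reflection n * d = addrow_mat n 1 0 1"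
    using Dp by (auto simp: E_def)
qed

lemma subgroup_shear_reflection:
  assumes "n \<ge> 3"
  shows "subgroup {1\<^sub>m n, shear_reflection n} (SLZ n)"
proof -
  interpret group "SLZ n" by (rule group_SLZ)
  note s = shear_reflection_mem[OF assms] shear_reflection_square[OF assms]
  have inv: "inv\<^bsub>SLZ n\<^esub> (shear_reflection n) = shear_reflection n"
    by (rule inv_SLZ_eqI) (use s in auto)
  have inv1: "inv\<^bsub>SLZ n\<^esub> (1\<^sub>m n) = 1\<^sub>m n" using inv_one by simp
  have one: "1\<^sub>m n \<in> carrier (SLZ n)" using one_closed by simp
  have "shear_reflection n \<in> carrier_mat n n" using s by (simp add: carrier_SLZ_iff)
  then show ?thesis using s inv inv1 one
    by (intro subgroupI) auto
qed

lemma generate_SLZ: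
  assumes n: "n \<ge> 3"
  shows "generate (SLZ n) (signed_permutations n \<union> {1\<^sub>m n, shear_reflection n}) = carrier (SLZ n)"
proof -
  interpret group "SLZ n" by (rule group_SLZ)
  let ?X = "signed_permutations n \<union> {1\<^sub>m n, shear_reflection n}"
  define K where "K = generate (SLZ n) ?X"
  have Xc: "?X \<subseteq> carrier (SLZ n)"
    using subgroup.subset[OF subgroup_signed_permutations[of n]]
      subgroup.subset[OF subgroup_shear_reflection[OF n]] by blast
  have K: "subgroup K (SLZ n)" unfolding K_def by (rule generate_is_subgroup[OF Xc])
  have KX: "?X \<subseteq> K" unfolding K_def by (auto intro: generate.incl)
  have Kmult: "g * h \<in> K" if "g \<in> K" "h \<in> K" for g h using subgroup.m_closed[OF K that] by simp
  have Kc: "g \<in> carrier (SLZ n)" if "g \<in> K" for g by (rule subgroup.mem_carrier[OF K that])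
  have neg: "addrow_mat n (- a) k l \<in> K" if "addrow_mat n a k l \<in> K" "k < n" "l < n" "k \<noteq> l" for a k l
  proof -
    have "inv\<^bsub>SLZ n\<^esub> (addrow_mat n a k l) = addrow_mat n (- a) k l"
      using that addrow_mat_inv[of k n l "- a"] by (intro inv_SLZ_eqI addrow_mat_mem_SLZ) auto
    then show ?thesis using subgroup.m_inv_closed[OF K that(1)] by simp
  qed
  define J where "J k l \<longleftrightarrow> addrow_mat n 1 k l \<in> K" for k l
  have swap: "J (Transposition.transpose i j k) (Transposition.transpose i j l)"
    if sw: "J k l" "i < n" "j < n" "k < n" "l < n" "k \<noteq> l" for i j k l
  proof (cases "i = j")
    case True then show ?thesis using sw by simp
  next
    case ij: False
    let ?W = "signed_swap n i j" and ?k = "Transposition.transpose i j k" and ?l = "Transposition.transpose i j l"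
    obtain b where b: "b = 1 \<or> b = - 1"
      "?W * addrow_mat n 1 k l = addrow_mat n b ?k ?l * ?W"
      using signed_swap_addrow_mat[OF sw(2,3) ij sw(4-6), of 1] by auto
    have W: "?W \<in> K" using signed_swap_mem[OF sw(2,3) ij] KX by blast
    have kl: "?k < n" "?l < n" "?k \<noteq> ?l" using sw by (auto simp: Transposition.transpose_def)
    have "?W * addrow_mat n 1 k l \<in> K" using Kmult W sw(1) by (simp add: J_def)
    then have "(addrow_mat n b ?k ?l \<otimes>\<^bsub>SLZ n\<^esub> ?W) \<otimes>\<^bsub>SLZ n\<^esub> inv\<^bsub>SLZ n\<^esub> ?W \<in> K"
      using subgroup.m_closed[OF K _ subgroup.m_inv_closed[OF K W]] b(2) by simp
    then have "addrow_mat n b ?k ?l \<in> K"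
      using inv_solve_right[of "addrow_mat n b ?k ?l"] Kc[OF W] addrow_mat_mem_SLZ[OF kl(3), of n b]
      by (metis m_assoc r_inv r_one inv_closed)
    then show ?thesis using b(1) neg[of "- 1" ?k ?l] kl by (auto simp: J_def)
  qed
  \<comment> \<open>The involution times a diagonal signed permutation is the first elementary matrix; two
    transpositions carry the index pair (0, 1) to any other pair.\<close>
  have J01: "J 0 1"
    using shear_reflection_factor[OF n] Kmult KX unfolding J_def by (metis UnI1 UnI2 insertI1 insertI2 subsetD)
  have Jkl: "J k l" if kl: "k < n" "l < n" "k \<noteq> l" for k l
  proof -
    define m where "m = Transposition.transpose 0 k 1"
    have "J (Transposition.transpose 0 k 0) m"
      unfolding m_def using kl n by (intro swap J01) auto
    then have Jm: "J k m" by simp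
    have m: "m < n" "m \<noteq> k" unfolding m_def using kl n by (auto simp: Transposition.transpose_def)
    have "J (Transposition.transpose m l k) (Transposition.transpose m l m)"
      using kl m by (intro swap Jm) auto
    moreover have "Transposition.transpose m l k = k" using m kl by (auto simp: Transposition.transpose_def)
    ultimately show ?thesis by simp
  qed
  have nat: "addrow_mat n (int m) k l \<in> K" if kl: "k < n" "l < n" "k \<noteq> l" for m k l
  proof (induction m)
    case 0
    have "addrow_mat n (0::int) k l = 1\<^sub>m n" by (intro eq_matI) auto
    then show ?case using KX by simp
  next
    case (Suc m)
    have "addrow_mat n (int (Suc m)) k l = addrow_mat n 1 k l * addrow_mat n (int m) k l"
      using addrow_mat_add[OF kl, of 1 "int m"] by (simp add: add.commute)
    then show ?case using Kmult[OF _ Suc] Jkl[OF kl] by (simp add: J_def)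
  qed
  have "elementary_closed n K"
  proof (rule elementary_closed.intro)
    show "subgroup K (SLZ n)" by (rule K)
    fix a :: int and k l :: nat assume kl: "k < n" "l < n" "k \<noteq> l"
    show "addrow_mat n a k l \<in> K"
    proof (cases "a \<ge> 0")
      case True then show ?thesis using nat[OF kl, of "nat a"] by simp
    next
      case False then show ?thesis using neg[OF nat[OF kl, of "nat (- a)"] kl] by simp
    qed
  qed
  then show ?thesis
    using elementary_closed.carrier_subset subgroup.subset[OF K] unfolding K_def by blast
qed

section \<open>Rational vectors and covectors\<close>

text \<open>
Vectors and covectors are functions on the naturals of which only the first \<open>n\<close> values matter.
Rational entries suffice, since no limit is ever taken, and they allow integral transvections.
\<close>

definition pairing :: "nat \<Rightarrow> (nat \<Rightarrow> rat) \<Rightarrow> (nat \<Rightarrow> rat) \<Rightarrow> rat" where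
  "pairing n \<chi> y = (\<Sum>i<n. \<chi> i * y i)"

definition act :: "nat \<Rightarrow> int mat \<Rightarrow> (nat \<Rightarrow> rat) \<Rightarrow> nat \<Rightarrow> rat" where
  "act n g y = (\<lambda>i. if i < n then \<Sum>j<n. of_int (g $$ (i, j)) * y j else 0)"

text \<open>
Balls for the maximum norm: their condition can be tested and altered one coordinate at a time.
\<close>

definition near :: "nat \<Rightarrow> (nat \<Rightarrow> rat) \<Rightarrow> rat \<Rightarrow> (nat \<Rightarrow> rat) \<Rightarrow> bool" where
  "near n v r y \<longleftrightarrow> (\<forall>i<n. \<bar>y i - v i\<bar> < r)"

lemma pairing_scale [simp]: "pairing n \<chi> (\<lambda>i. s * y i) = s * pairing n \<chi> y"
  by (simp add: pairing_def sum_distrib_left mult.left_commute)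

lemma pairing_cong: "(\<And>i. i < n \<Longrightarrow> y i = z i) \<Longrightarrow> pairing n \<chi> y = pairing n \<chi> z"
  by (simp add: pairing_def)

lemma pairing_add_scale: "pairing n \<chi> (\<lambda>i. y i + s * z i) = pairing n \<chi> y + s * pairing n \<chi> z"
  by (simp add: pairing_def sum_distrib_left algebra_simps sum.distrib)

lemma pairing_update_right:
  assumes "i < n"
  shows "pairing n \<chi> (y(i := y i + a)) = pairing n \<chi> y + a * \<chi> i"
proof -
  have "pairing n \<chi> (y(i := y i + a)) = (\<Sum>k<n. \<chi> k * y k + (if k = i then a * \<chi> k else 0))"
    unfolding pairing_def by (intro sum.cong) (auto simp: algebra_simps)
  then show ?thesis using assms by (simp add: sum.distrib pairing_def)
qed

lemma pairing_commute: "pairing n \<chi> y = pairing n y \<chi>"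
  by (simp add: pairing_def mult.commute)

lemma pairing_update_left:
  "i < n \<Longrightarrow> pairing n (\<chi>(i := \<chi> i + a)) y = pairing n \<chi> y + a * y i"
  using pairing_update_right[of i n y \<chi> a] by (simp add: pairing_commute)

lemma act_mult:
  assumes "g \<in> carrier_mat n n" "h \<in> carrier_mat n n"
  shows "act n (g * h) y = act n g (act n h y)"
proof
  fix i
  show "act n (g * h) y i = act n g (act n h y) i"
  proof (cases "i < n")
    case True
    have "act n (g * h) y i = (\<Sum>j<n. (\<Sum>k<n. of_int (g $$ (i, k)) * of_int (h $$ (k, j))) * y j)"
      using True assms by (simp add: act_def scalar_prod_def atLeast0LessThan)
    also have "\<dots> = (\<Sum>j<n. \<Sum>k<n. of_int (g $$ (i, k)) * (of_int (h $$ (k, j)) * y j))"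
      by (simp add: sum_distrib_right mult.assoc)
    also have "\<dots> = (\<Sum>k<n. \<Sum>j<n. of_int (g $$ (i, k)) * (of_int (h $$ (k, j)) * y j))"
      by (rule sum.swap)
    also have "\<dots> = act n g (act n h y) i"
      using True by (simp add: act_def sum_distrib_left)
    finally show ?thesis .
  qed (simp add: act_def)
qed

lemma act_one: "i < n \<Longrightarrow> act n (1\<^sub>m n) y i = y i"
proof -
  assume i: "i < n"
  have "act n (1\<^sub>m n) y i = (\<Sum>j<n. if j = i then y j else 0)"
    unfolding act_def if_P[OF i] using i by (intro sum.cong) auto
  then show ?thesis using i by simp
qed

lemma act_scale: "act n g (\<lambda>i. s * y i) i = s * act n g y i"
  by (simp add: act_def sum_distrib_left mult.left_commute)

lemma act_add_scale: "act n g (\<lambda>i. y i + s * z i) i = act n g y i + s * act n g z i"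
  by (simp add: act_def sum_distrib_left algebra_simps sum.distrib)

lemma act_cong: "(\<And>i. i < n \<Longrightarrow> y i = z i) \<Longrightarrow> act n g y = act n g z"
  by (auto simp: act_def fun_eq_iff)

lemma pairing_act:
  "pairing n \<chi> (act n g y) = (\<Sum>i<n. \<Sum>j<n. of_int (g $$ (i, j)) * (\<chi> i * y j))"
  by (simp add: pairing_def act_def sum_distrib_left mult.left_commute)

lemma pairing_act_columns:
  "pairing n \<chi> (act n g y) = pairing n (\<lambda>j. pairing n \<chi> (\<lambda>i. of_int (g $$ (i, j)))) y"
proof -
  have "pairing n \<chi> (act n g y) = (\<Sum>j<n. \<Sum>i<n. of_int (g $$ (i, j)) * (\<chi> i * y j))"
    unfolding pairing_act by (rule sum.swap)
  also have "\<dots> = pairing n (\<lambda>j. pairing n \<chi> (\<lambda>i. of_int (g $$ (i, j)))) y"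
    by (simp add: pairing_def sum_distrib_left mult_ac)
  finally show ?thesis .
qed

lemma near_subball:
  assumes "near n v (r / 2) v'" "r' \<le> r / 2" "near n v' r' y"
  shows "near n v r y"
  unfolding near_def
proof (intro allI impI)
  fix i assume "i < n"
  then have "\<bar>v' i - v i\<bar> < r / 2" "\<bar>y i - v' i\<bar> < r'" using assms by (auto simp: near_def)
  then show "\<bar>y i - v i\<bar> < r" using assms(2) by linarith
qed

lemma near_mono: "near n v r y \<Longrightarrow> r \<le> r' \<Longrightarrow> near n v r' y"
  by (fastforce simp: near_def)

lemma near_refl: "r > 0 \<Longrightarrow> near n v r v"
  by (simp add: near_def)

lemma pairing_act_nonzero_nearby:
  assumes "pairing n \<phi> (act n g v) \<noteq> 0"
  shows "\<exists>r>0. \<forall>\<chi> y. near n \<phi> r \<chi> \<longrightarrow> near n v r y \<longrightarrow> pairing n \<chi> (act n g y) \<noteq> 0"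
proof -
  define c where "c = pairing n \<phi> (act n g v)"
  define S where "S = (\<Sum>i<n. \<Sum>j<n. \<bar>of_int (g $$ (i, j))\<bar> * (1 + \<bar>v j\<bar> + \<bar>\<phi> i\<bar>))"
  have S: "S \<ge> 0" unfolding S_def by (intro sum_nonneg) simp
  define r where "r = min 1 (\<bar>c\<bar> / (S + 1))"
  have c: "\<bar>c\<bar> > 0" using assms by (simp add: c_def)
  have r: "r > 0" "r \<le> 1" "r \<le> \<bar>c\<bar> / (S + 1)" using c S by (auto simp: r_def)
  have "r * S < \<bar>c\<bar>"
  proof -
    have "r * S \<le> \<bar>c\<bar> / (S + 1) * S" using r(3) S by (rule mult_right_mono)
    also have "\<dots> < \<bar>c\<bar>" using c S by (simp add: field_simps)
    finally show ?thesis .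
  qed
  moreover have "\<bar>pairing n \<chi> (act n g y) - c\<bar> \<le> r * S" if "near n \<phi> r \<chi>" "near n v r y" for \<chi> y
  proof -
    have prod: "\<bar>\<chi> i * y j - \<phi> i * v j\<bar> \<le> r * (1 + \<bar>v j\<bar> + \<bar>\<phi> i\<bar>)" if ij: "i < n" "j < n" for i j
    proof -
      have d: "\<bar>\<chi> i - \<phi> i\<bar> \<le> r" "\<bar>y j - v j\<bar> \<le> r"
        using \<open>near n \<phi> r \<chi>\<close> \<open>near n v r y\<close> ij by (auto simp: near_def less_imp_le)
      have "\<chi> i * y j - \<phi> i * v j =
          (\<chi> i - \<phi> i) * (y j - v j) + (\<chi> i - \<phi> i) * v j + \<phi> i * (y j - v j)"
        by (simp add: algebra_simps)
      also have "\<bar>\<dots>\<bar> \<le> \<bar>\<chi> i - \<phi> i\<bar> * \<bar>y j - v j\<bar> + \<bar>\<chi> i - \<phi> i\<bar> * \<bar>v j\<bar> + \<bar>\<phi> i\<bar> * \<bar>y j - v j\<bar>"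
        unfolding abs_mult[symmetric] by linarith
      also have "\<dots> \<le> r * 1 + r * \<bar>v j\<bar> + \<bar>\<phi> i\<bar> * r"
        using d r by (intro add_mono mult_mono) auto
      finally show ?thesis by (simp add: algebra_simps)
    qed
    have "\<bar>pairing n \<chi> (act n g y) - c\<bar> =
        \<bar>\<Sum>i<n. \<Sum>j<n. of_int (g $$ (i, j)) * (\<chi> i * y j - \<phi> i * v j)\<bar>"
      unfolding c_def pairing_act by (simp add: sum_subtractf right_diff_distrib)
    also have "\<dots> \<le> (\<Sum>i<n. \<Sum>j<n. \<bar>of_int (g $$ (i, j)) * (\<chi> i * y j - \<phi> i * v j)\<bar>)"
      by (intro order_trans[OF sum_abs] sum_mono) simp
    also have "\<dots> \<le> (\<Sum>i<n. \<Sum>j<n. \<bar>of_int (g $$ (i, j))\<bar> * (r * (1 + \<bar>v j\<bar> + \<bar>\<phi> i\<bar>)))"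
      unfolding abs_mult using prod by (intro sum_mono mult_left_mono) auto
    also have "\<dots> = r * S" by (simp add: S_def sum_distrib_left mult.left_commute)
    finally show ?thesis .
  qed
  ultimately have "pairing n \<chi> (act n g y) \<noteq> 0" if "near n \<phi> r \<chi>" "near n v r y" for \<chi> y
    using that by fastforce
  then show ?thesis using r(1) by blast
qed

lemma pairing_nonzero_nearby:
  assumes "pairing n \<phi> v \<noteq> 0"
  shows "\<exists>r>0. \<forall>\<chi> y. near n \<phi> r \<chi> \<longrightarrow> near n v r y \<longrightarrow> pairing n \<chi> y \<noteq> 0"
proof -
  have "pairing n \<chi> (act n (1\<^sub>m n) y) = pairing n \<chi> y" for \<chi> y
    by (intro pairing_cong) (simp add: act_one)
  then show ?thesis using pairing_act_nonzero_nearby[of n \<phi> "1\<^sub>m n" v] assms by simp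
qed

text \<open>
A Harnack type inequality: were a coordinate of \<open>z\<close> too large in comparison with \<open>\<phi>(z)\<close>, a
small change of the same coordinate of \<open>\<phi>\<close> would already give a covector that kills \<open>z\<close>. It turns
the qualitative condition of being nonzero on a ball into a uniform bound.
\<close>

lemma nonvanishing_on_ball_bound:
  assumes r: "r > 0" and nz: "\<And>\<chi>. near n \<phi> r \<chi> \<Longrightarrow> pairing n \<chi> z \<noteq> 0" and i: "i < n"
  shows "\<bar>z i\<bar> \<le> 1 / r * \<bar>pairing n \<phi> z\<bar>"
proof (rule ccontr)
  assume "\<not> ?thesis"
  then have less: "\<bar>pairing n \<phi> z\<bar> / r < \<bar>z i\<bar>" by simp
  have "0 \<le> \<bar>pairing n \<phi> z\<bar> / r" using r by simp
  then have zi: "\<bar>z i\<bar> > 0" "z i \<noteq> 0" using less by auto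
  define a where "a = - pairing n \<phi> z / z i"
  have "\<bar>a\<bar> < r" using less zi r by (simp add: a_def abs_divide field_simps)
  then have "near n \<phi> r (\<phi>(i := \<phi> i + a))" using r by (simp add: near_def)
  then have "pairing n (\<phi>(i := \<phi> i + a)) z \<noteq> 0" by (rule nz)
  then show False unfolding pairing_update_left[OF i] using zi by (simp add: a_def)
qed

definition transversal :: "nat \<Rightarrow> (nat \<Rightarrow> rat) \<Rightarrow> (nat \<Rightarrow> rat) \<Rightarrow> rat \<Rightarrow> int mat set \<Rightarrow> bool" where
  "transversal n v \<phi> r X \<longleftrightarrow>
     (\<forall>g\<in>X. \<forall>\<chi> y. near n \<phi> r \<chi> \<longrightarrow> near n v r y \<longrightarrow> pairing n \<chi> (act n g y) \<noteq> 0)"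

text \<open>
Nonzero coordinates make sure that every elementary shear moves both the vector and the hyperplane.
\<close>

definition generic_flag :: "nat \<Rightarrow> (nat \<Rightarrow> rat) \<Rightarrow> (nat \<Rightarrow> rat) \<Rightarrow> bool" where
  "generic_flag n v \<phi> \<longleftrightarrow> pairing n \<phi> v = 0 \<and> (\<forall>i<n. v i \<noteq> 0 \<and> \<phi> i \<noteq> 0)"

text \<open>
The action of the elementary matrix with entry \<open>t\<close> in row \<open>i\<close> and column \<open>j\<close>. The dual action on
covectors has the indices exchanged and the sign of \<open>t\<close> reversed, and the pairing is preserved.
\<close>

definition shear_vector :: "nat \<Rightarrow> nat \<Rightarrow> rat \<Rightarrow> (nat \<Rightarrow> rat) \<Rightarrow> nat \<Rightarrow> rat" where
  "shear_vector i j t v = v(i := v i + t * v j)"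

lemma generic_flag_shear:
  assumes inc: "generic_flag n v \<phi>" and ij: "i < n" "j < n" "i \<noteq> j" and r: "r > 0"
  shows "\<exists>e>0. \<forall>t. \<bar>t\<bar> < e \<longrightarrow> generic_flag n (shear_vector i j t v) (shear_vector j i (- t) \<phi>) \<and>
    near n v r (shear_vector i j t v) \<and> near n \<phi> r (shear_vector j i (- t) \<phi>)"
proof -
  have nz: "v j \<noteq> 0" "\<phi> i \<noteq> 0" "v i \<noteq> 0" "\<phi> j \<noteq> 0" using inc ij by (auto simp: generic_flag_def)
  define e where "e = min (min (r / \<bar>v j\<bar>) (r / \<bar>\<phi> i\<bar>)) (min (\<bar>v i\<bar> / \<bar>v j\<bar>) (\<bar>\<phi> j\<bar> / \<bar>\<phi> i\<bar>))"
  have "e > 0" using nz r by (simp add: e_def)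
  moreover have "generic_flag n (shear_vector i j t v) (shear_vector j i (- t) \<phi>) \<and>
    near n v r (shear_vector i j t v) \<and> near n \<phi> r (shear_vector j i (- t) \<phi>)" if "\<bar>t\<bar> < e" for t
  proof -
    have small: "\<bar>t * v j\<bar> < r" "\<bar>t * \<phi> i\<bar> < r" "\<bar>t * v j\<bar> < \<bar>v i\<bar>" "\<bar>t * \<phi> i\<bar> < \<bar>\<phi> j\<bar>"
      using that nz by (auto simp: e_def abs_mult pos_less_divide_eq)
    have "pairing n (shear_vector j i (- t) \<phi>) (shear_vector i j t v) =
        pairing n \<phi> v + t * v j * \<phi> i - t * \<phi> i * v j"
      using ij pairing_update_left[of j n \<phi> "- t * \<phi> i" "shear_vector i j t v"]
        pairing_update_right[of i n \<phi> v "t * v j"]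
      by (simp add: shear_vector_def)
    also have "\<dots> = 0" using inc by (simp add: generic_flag_def)
    finally have "pairing n (shear_vector j i (- t) \<phi>) (shear_vector i j t v) = 0" .
    moreover have "shear_vector i j t v k \<noteq> 0 \<and> shear_vector j i (- t) \<phi> k \<noteq> 0" if "k < n" for k
    proof -
      have "v i + t * v j \<noteq> 0" "\<phi> j + - t * \<phi> i \<noteq> 0" using small by auto
      then show ?thesis using inc that ij by (auto simp: shear_vector_def generic_flag_def)
    qed
    moreover have "near n v r (shear_vector i j t v)" "near n \<phi> r (shear_vector j i (- t) \<phi>)"
      using small r by (auto simp: near_def shear_vector_def)
    ultimately show ?thesis by (simp add: generic_flag_def)
  qed
  ultimately show ?thesis by blast
qed

lemma pairing_act_shear:
  assumes ij: "i < n" "j < n" "i \<noteq> j"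
  shows "pairing n (shear_vector j i (- t) \<phi>) (act n g (shear_vector i j t v)) =
    pairing n \<phi> (act n g v)
    + t * (v j * pairing n \<phi> (\<lambda>k. of_int (g $$ (k, i))) - \<phi> i * act n g v j
           - t * (v j * \<phi> i * of_int (g $$ (j, i))))"
proof -
  define \<psi> where "\<psi> = shear_vector j i (- t) \<phi>"
  have \<psi>: "pairing n \<psi> y = pairing n \<phi> y - t * \<phi> i * y j" for y
    using pairing_update_left[of j n \<phi> "- t * \<phi> i" y] ij by (simp add: \<psi>_def shear_vector_def)
  have "pairing n \<psi> (act n g (shear_vector i j t v)) =
      pairing n \<psi> (act n g v) + t * v j * pairing n \<psi> (\<lambda>k. of_int (g $$ (k, i)))"
    unfolding pairing_act_columns shear_vector_def using pairing_update_right ij by simp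
  then show ?thesis unfolding \<psi>_def[symmetric] unfolding \<psi> by (simp add: algebra_simps)
qed

text \<open>
Shearing the pair by \<open>t\<close> turns \<open>\<phi>(g v)\<close> into a polynomial in \<open>t\<close> of degree at most 2. Its
quadratic coefficient involves an entry of \<open>g\<close> off the diagonal; if all of these vanish, the linear
one involves the difference of two diagonal entries. For nonscalar \<open>g\<close> some shear thus gives a
nonzero polynomial, which does not vanish at suitable small \<open>t\<close>.
\<close>

lemma ex_generic_flag_moved:
  assumes g: "g \<in> carrier_mat n n" and nonscalar: "\<nexists>c. g = c \<cdot>\<^sub>m 1\<^sub>m n"
    and inc: "generic_flag n v \<phi>" and r: "r > 0"
  shows "\<exists>v' \<phi>'. generic_flag n v' \<phi>' \<and> near n v r v' \<and> near n \<phi> r \<phi>' \<and> pairing n \<phi>' (act n g v') \<noteq> 0"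
proof (cases "pairing n \<phi> (act n g v) = 0")
  case False
  then show ?thesis using inc near_refl[OF r] by blast
next
  case zero: True
  define c1 where "c1 i j = v j * pairing n \<phi> (\<lambda>k. of_int (g $$ (k, i))) - \<phi> i * act n g v j" for i j
  define c2 where "c2 i j = v j * \<phi> i * of_int (g $$ (j, i))" for i j
  have nz: "v i \<noteq> 0" "\<phi> i \<noteq> 0" if "i < n" for i using inc that by (auto simp: generic_flag_def)
  have "\<exists>i j. i < n \<and> j < n \<and> i \<noteq> j \<and> (c1 i j \<noteq> 0 \<or> c2 i j \<noteq> 0)"
  proof (cases "\<exists>i j. i < n \<and> j < n \<and> i \<noteq> j \<and> g $$ (j, i) \<noteq> 0")
    case True
    then show ?thesis using nz unfolding c2_def by fastforce
  next
    case False
    then have diag: "g $$ (j, i) = 0" if "i < n" "j < n" "i \<noteq> j" for i j using that by blast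
    have "\<exists>i j. i < n \<and> j < n \<and> g $$ (i, i) \<noteq> g $$ (j, j)"
    proof (rule ccontr)
      assume none: "\<nexists>i j. i < n \<and> j < n \<and> g $$ (i, i) \<noteq> g $$ (j, j)"
      define c where "c = g $$ (0, 0)"
      have "g $$ (i, i) = c" if "i < n" for i
      proof -
        have "0 < n" using that by simp
        then show ?thesis unfolding c_def using none that by metis
      qed
      then have "g = c \<cdot>\<^sub>m 1\<^sub>m n"
        using g diag by (intro eq_matI) auto
      then show False using nonscalar by blast
    qed
    then obtain i j where ij: "i < n" "j < n" "g $$ (i, i) \<noteq> g $$ (j, j)" by blast
    have "pairing n \<phi> (\<lambda>k. of_int (g $$ (k, i))) = (\<Sum>k<n. if k = i then \<phi> i * of_int (g $$ (i, i)) else 0)"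
      unfolding pairing_def using diag ij by (intro sum.cong) auto
    moreover have "act n g v j = (\<Sum>k<n. if k = j then of_int (g $$ (j, j)) * v j else 0)"
      unfolding act_def if_P[OF ij(2)] using diag ij by (intro sum.cong) auto
    ultimately have "c1 i j = v j * \<phi> i * (of_int (g $$ (i, i)) - of_int (g $$ (j, j)))"
      using ij by (simp add: c1_def algebra_simps)
    then have "c1 i j \<noteq> 0" using nz ij by simp
    then show ?thesis using ij by blast
  qed
  then obtain i j where ij: "i < n" "j < n" "i \<noteq> j" and c: "c1 i j \<noteq> 0 \<or> c2 i j \<noteq> 0" by blast
  obtain e where e: "e > 0" and small: "\<And>t. \<bar>t\<bar> < e \<Longrightarrow>
      generic_flag n (shear_vector i j t v) (shear_vector j i (- t) \<phi>) \<and>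
      near n v r (shear_vector i j t v) \<and> near n \<phi> r (shear_vector j i (- t) \<phi>)"
    using generic_flag_shear[OF inc ij r] by blast
  have "\<exists>t. \<bar>t\<bar> < e \<and> t \<noteq> 0 \<and> c1 i j - t * c2 i j \<noteq> 0"
  proof (rule ccontr)
    assume "\<not> ?thesis"
    then have "c1 i j - t * c2 i j = 0" if "\<bar>t\<bar> < e" "t \<noteq> 0" for t using that by blast
    \<comment> \<open>A linear polynomial with two different zeros is zero.\<close>
    from this[of "e / 2"] this[of "e / 4"] have "c1 i j = e / 2 * c2 i j" "c1 i j = e / 4 * c2 i j"
      using e by auto
    then have "c2 i j = 0" "c1 i j = 0" using e by auto
    then show False using c by blast
  qed
  then obtain t where t: "\<bar>t\<bar> < e" "t \<noteq> 0" "c1 i j - t * c2 i j \<noteq> 0" by blast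
  have "pairing n (shear_vector j i (- t) \<phi>) (act n g (shear_vector i j t v)) = t * (c1 i j - t * c2 i j)"
    unfolding pairing_act_shear[OF ij] zero c1_def c2_def by simp
  then have "pairing n (shear_vector j i (- t) \<phi>) (act n g (shear_vector i j t v)) \<noteq> 0" using t by simp
  then show ?thesis using small[OF t(1)] by blast
qed

text \<open>
Being moved off the hyperplane is an open condition, so the matrices can be treated one after the
other on shrinking neighbourhoods.
\<close>

lemma ex_transversal_finite:
  assumes "finite X" "\<And>g. g \<in> X \<Longrightarrow> g \<in> carrier_mat n n \<and> (\<nexists>c. g = c \<cdot>\<^sub>m 1\<^sub>m n)"
    and inc: "generic_flag n v \<phi>" and r: "r > 0"
  shows "\<exists>v' \<phi>' r'. r' > 0 \<and> generic_flag n v' \<phi>' \<and> (\<forall>y. near n v' r' y \<longrightarrow> near n v r y) \<and>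
    (\<forall>\<chi>. near n \<phi>' r' \<chi> \<longrightarrow> near n \<phi> r \<chi>) \<and> transversal n v' \<phi>' r' X"
  using assms(1,2)
proof (induction X rule: finite_induct)
  case empty
  then show ?case using inc r unfolding transversal_def by blast
next
  case (insert g X)
  then obtain v1 \<phi>1 r1 where 1: "r1 > 0" "generic_flag n v1 \<phi>1"
    "\<forall>y. near n v1 r1 y \<longrightarrow> near n v r y" "\<forall>\<chi>. near n \<phi>1 r1 \<chi> \<longrightarrow> near n \<phi> r \<chi>"
    "transversal n v1 \<phi>1 r1 X" by auto
  obtain v2 \<phi>2 where 2: "generic_flag n v2 \<phi>2" "near n v1 (r1 / 2) v2" "near n \<phi>1 (r1 / 2) \<phi>2"
    "pairing n \<phi>2 (act n g v2) \<noteq> 0"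
    using ex_generic_flag_moved[OF _ _ 1(2), of g "r1 / 2"] insert.prems 1(1) by auto
  obtain s where s: "s > 0" "\<forall>\<chi> y. near n \<phi>2 s \<chi> \<longrightarrow> near n v2 s y \<longrightarrow> pairing n \<chi> (act n g y) \<noteq> 0"
    using pairing_act_nonzero_nearby[OF 2(4)] by blast
  define r2 where "r2 = min s (r1 / 2)"
  have sub: "near n v1 r1 y" if "near n v2 r2 y" for y
    using near_subball[OF 2(2) _ that] by (simp add: r2_def)
  have sub': "near n \<phi>1 r1 \<chi>" if "near n \<phi>2 r2 \<chi>" for \<chi>
    using near_subball[OF 2(3) _ that] by (simp add: r2_def)
  have g: "pairing n \<chi> (act n g y) \<noteq> 0" if "near n \<phi>2 r2 \<chi>" "near n v2 r2 y" for \<chi> y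
    using s(2) near_mono[OF that(1), of s] near_mono[OF that(2), of s] by (simp add: r2_def)
  have "transversal n v2 \<phi>2 r2 (insert g X)"
    using 1(5) sub sub' g unfolding transversal_def by blast
  moreover have "r2 > 0" using s 1 by (simp add: r2_def)
  ultimately show ?case using 2(1) 1(3,4) sub sub' by blast
qed

lemma ex_common_denominator:
  fixes X :: "rat set"
  assumes "finite X"
  shows "\<exists>d::int. d > 0 \<and> (\<forall>x\<in>X. \<exists>m::int. of_int d * x = of_int m)"
  using assms
proof (induction X rule: finite_induct)
  case empty
  then show ?case by (intro exI[of _ 1]) simp
next
  case (insert x X)
  then obtain d :: int where d: "d > 0" "\<forall>x\<in>X. \<exists>m::int. of_int d * x = of_int m" by blast
  obtain p q where pq: "quotient_of x = (p, q)" by fastforce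
  then have q: "q > 0" "x = of_int p / of_int q"
    using quotient_of_denom_pos quotient_of_div by auto
  have "of_int (d * q) * x = of_int (d * p)" using q by simp
  then have "\<exists>m::int. of_int (d * q) * x = of_int m" by blast
  moreover have "\<exists>m::int. of_int (d * q) * y = of_int m" if y: "y \<in> X" for y
  proof -
    obtain m :: int where "of_int d * y = of_int m" using d y by blast
    then have "of_int (d * q) * y = of_int (m * q)" by (simp add: mult.assoc mult.left_commute)
    then show ?thesis by blast
  qed
  moreover have "d * q > 0" using d(1) q(1) by simp
  ultimately show ?case by blast
qed

text \<open>
Multiples of \<open>v \<phi>\<close> add up under multiplication because \<open>\<phi>(v) = 0\<close>. Clearing denominators
makes them integral, and twice as large ones have determinant 1, being squares of integral matrices
with determinant \<open>1\<close> or \<open>-1\<close>.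
\<close>

lemma ex_integral_transvections:
  assumes orth: "pairing n \<phi> v = 0"
  shows "\<exists>(T :: int \<Rightarrow> int mat) D. D > 0 \<and> (\<forall>k. T k \<in> carrier (SLZ n)) \<and> T 0 = 1\<^sub>m n \<and>
    (\<forall>k l. T k * T l = T (k + l)) \<and>
    (\<forall>k y i. i < n \<longrightarrow> act n (T k) y i = y i + of_int k * D * pairing n \<phi> y * v i)"
proof -
  have "finite ((\<lambda>(i, j). v i * \<phi> j) ` ({..<n} \<times> {..<n}))" by simp
  then obtain d :: int where d: "d > 0"
    and "\<forall>x\<in>(\<lambda>(i, j). v i * \<phi> j) ` ({..<n} \<times> {..<n}). \<exists>m::int. of_int d * x = of_int m"
    using ex_common_denominator by blast
  then have "\<exists>m::int. of_int d * (v i * \<phi> j) = of_int m" if "i < n" "j < n" for i j using that by auto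
  then obtain a :: "nat \<Rightarrow> nat \<Rightarrow> int"
    where a: "of_int (a i j) = of_int d * (v i * \<phi> j)" if "i < n" "j < n" for i j by metis
  define U where "U k = mat n n (\<lambda>(i, j). (if i = j then 1 else 0) + k * a i j)" for k
  have Uc: "U k \<in> carrier_mat n n" for k by (simp add: U_def)
  have aa: "(\<Sum>m<n. a i m * a m j) = 0" if ij: "i < n" "j < n" for i j
  proof -
    have "rat_of_int (\<Sum>m<n. a i m * a m j) = (\<Sum>m<n. of_int d * v i * of_int d * \<phi> j * (\<phi> m * v m))"
      using a ij by (auto intro!: sum.cong)
    also have "\<dots> = of_int d * v i * of_int d * \<phi> j * pairing n \<phi> v"
      by (simp add: pairing_def sum_distrib_left)
    finally have "rat_of_int (\<Sum>m<n. a i m * a m j) = 0" using orth by simp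
    then show ?thesis by (simp only: of_int_eq_0_iff)
  qed
  have Uadd: "U k * U l = U (k + l)" for k l
  proof (rule eq_matI)
    fix i j assume "i < dim_row (U (k + l))" "j < dim_col (U (k + l))"
    then have ij: "i < n" "j < n" by (auto simp: U_def)
    have "(U k * U l) $$ (i, j) =
        (\<Sum>m<n. ((if i = m then 1 else 0) + k * a i m) * ((if m = j then 1 else 0) + l * a m j))"
      using ij by (simp add: U_def scalar_prod_def atLeast0LessThan)
    also have "\<dots> = (\<Sum>m<n. (if m = i then (if i = j then 1 else 0) + l * a i j else 0)
        + (if m = j then k * a i j else 0) + k * l * (a i m * a m j))"
      by (intro sum.cong) (auto simp: algebra_simps)
    also have "\<dots> = (if i = j then 1 else 0) + l * a i j + k * a i j + k * l * (\<Sum>m<n. a i m * a m j)"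
      using ij by (simp add: sum.distrib sum_distrib_left)
    also have "\<dots> = U (k + l) $$ (i, j)" unfolding aa[OF ij] using ij by (simp add: U_def algebra_simps)
    finally show "(U k * U l) $$ (i, j) = U (k + l) $$ (i, j)" .
  qed (auto simp: U_def)
  have U0: "U 0 = 1\<^sub>m n" by (intro eq_matI) (auto simp: U_def)
  have detU: "det (U (2 * k)) = 1" for k
  proof -
    have "det (U k) * det (U (- k)) = 1"
      using det_mult[OF Uc Uc, of k "- k"] by (simp add: Uadd U0)
    then have "det (U k) = 1 \<or> det (U k) = - 1" using zmult_eq_1_iff by blast
    moreover have "det (U (2 * k)) = det (U k) * det (U k)"
      using det_mult[OF Uc Uc, of k k] by (simp add: Uadd)
    ultimately show ?thesis by auto
  qed
  have actU: "act n (U k) y i = y i + of_int k * of_int d * pairing n \<phi> y * v i" if i: "i < n" for k y i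
  proof -
    have "act n (U k) y i = (\<Sum>j<n. (if j = i then y i else 0) + of_int k * of_int d * v i * (\<phi> j * y j))"
      using i a unfolding act_def U_def by (auto simp: algebra_simps intro!: sum.cong)
    also have "\<dots> = y i + of_int k * of_int d * v i * pairing n \<phi> y"
      using i by (simp add: sum.distrib pairing_def sum_distrib_left)
    finally show ?thesis by simp
  qed
  show ?thesis
    using d Uc Uadd U0 detU actU
    by (intro exI[of _ "\<lambda>k. U (2 * k)"] exI[of _ "2 * of_int d"])
      (auto simp: carrier_SLZ_iff algebra_simps)
qed

definition cone_around :: "nat \<Rightarrow> (nat \<Rightarrow> rat) \<Rightarrow> rat \<Rightarrow> (nat \<Rightarrow> rat) set" where
  "cone_around n v r = {x. \<exists>s. s \<noteq> 0 \<and> near n v r (\<lambda>i. x i / s)}"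

text \<open>
Here \<open>x\<close> is the image of \<open>z\<close> under \<open>\<gamma> f \<gamma>\<inverse>\<close> for the transvection \<open>\<gamma> y = y + N \<phi>(y) v\<close>,
and \<open>w\<close> is the intermediate vector \<open>\<gamma>\<inverse> z\<close>. Expanding gives
\<open>x = - N\<^sup>2 \<phi>(z) \<phi>(f v) v\<close> plus terms of order at most \<open>N \<phi>(z)\<close>, where the size of \<open>f z\<close> is
controlled by \<open>\<phi>(z)\<close> through the constant \<open>K\<close>; dividing by the coefficient of \<open>v\<close> leaves an error
of order \<open>1 / N\<close>.
\<close>

lemma conjugate_contracts:
  assumes orth: "pairing n \<phi> v = 0" and c: "pairing n \<phi> (act n f v) \<noteq> 0" and K: "K > 0" and r: "r > 0"
  shows "\<forall>\<^sub>F N in at_top. \<forall>z w x. pairing n \<phi> z \<noteq> 0 \<longrightarrow> (\<forall>i<n. \<bar>z i\<bar> \<le> K * \<bar>pairing n \<phi> z\<bar>) \<longrightarrow>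
    (\<forall>i<n. w i = z i - N * pairing n \<phi> z * v i) \<longrightarrow>
    (\<forall>i<n. x i = act n f w i + N * pairing n \<phi> (act n f w) * v i) \<longrightarrow> x \<in> cone_around n v r"
proof -
  define c where "c = pairing n \<phi> (act n f v)"
  have c0: "\<bar>c\<bar> > 0" "c \<noteq> 0" using assms(2) by (auto simp: c_def)
  define C where "C i = (\<Sum>j<n. \<bar>of_int (f $$ (i, j))\<bar> * K)" for i
  define Q where "Q = (\<Sum>i<n. \<bar>\<phi> i\<bar> * C i)"
  define A where "A i = C i + \<bar>act n f v i\<bar> + Q * \<bar>v i\<bar>" for i
  define S where "S = (\<Sum>i<n. A i)"
  have C0: "C i \<ge> 0" for i unfolding C_def using K by (intro sum_nonneg) simp
  have Q0: "Q \<ge> 0" unfolding Q_def using C0 by (intro sum_nonneg) simp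
  have A0: "A i \<ge> 0" for i unfolding A_def using C0 Q0 by simp
  have AS: "A i \<le> S" if "i < n" for i unfolding S_def using A0 that by (intro member_le_sum) auto
  have "x \<in> cone_around n v r"
    if N: "N \<ge> 1 + S / (\<bar>c\<bar> * r)" and p0: "pairing n \<phi> z \<noteq> 0"
      and zK: "\<forall>i<n. \<bar>z i\<bar> \<le> K * \<bar>pairing n \<phi> z\<bar>"
      and w: "\<forall>i<n. w i = z i - N * pairing n \<phi> z * v i"
      and x: "\<forall>i<n. x i = act n f w i + N * pairing n \<phi> (act n f w) * v i" for N z w x
  proof -
    define p where "p = pairing n \<phi> z"
    define q where "q = pairing n \<phi> (act n f z)"
    have p: "p \<noteq> 0" "\<bar>p\<bar> > 0" using p0 by (auto simp: p_def)
    have S0: "0 \<le> S" unfolding S_def using A0 by (intro sum_nonneg) simp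
    have "0 \<le> S / (\<bar>c\<bar> * r)" using S0 c0 r by simp
    then have N1: "N \<ge> 1" using N by linarith
    have "S / (\<bar>c\<bar> * r) < N" using N by linarith
    then have NS: "S < N * \<bar>c\<bar> * r" using c0 r by (simp add: field_simps)
    have fz: "\<bar>act n f z i\<bar> \<le> C i * \<bar>p\<bar>" if "i < n" for i
    proof -
      have "\<bar>act n f z i\<bar> \<le> (\<Sum>j<n. \<bar>of_int (f $$ (i, j)) * z j\<bar>)"
        using that by (simp add: act_def sum_abs)
      also have "\<dots> \<le> (\<Sum>j<n. \<bar>of_int (f $$ (i, j))\<bar> * (K * \<bar>p\<bar>))"
        unfolding abs_mult using zK by (intro sum_mono mult_left_mono) (auto simp: p_def)
      also have "\<dots> = C i * \<bar>p\<bar>" by (simp add: C_def sum_distrib_right mult.assoc)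
      finally show ?thesis .
    qed
    have qQ: "\<bar>q\<bar> \<le> Q * \<bar>p\<bar>"
    proof -
      have "\<bar>q\<bar> \<le> (\<Sum>i<n. \<bar>\<phi> i * act n f z i\<bar>)" by (simp add: q_def pairing_def sum_abs)
      also have "\<dots> \<le> (\<Sum>i<n. \<bar>\<phi> i\<bar> * (C i * \<bar>p\<bar>))"
        unfolding abs_mult using fz by (intro sum_mono mult_left_mono) auto
      also have "\<dots> = Q * \<bar>p\<bar>" by (simp add: Q_def sum_distrib_right mult.assoc)
      finally show ?thesis .
    qed
    have fw: "act n f w = act n f (\<lambda>i. z i + (- N * p) * v i)"
      using w by (intro act_cong) (simp add: p_def)
    have fwi: "act n f w i = act n f z i - N * p * act n f v i" for i
      unfolding fw act_add_scale by simp
    have pfw: "pairing n \<phi> (act n f w) = q - N * p * c"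
    proof -
      have "pairing n \<phi> (act n f w) = pairing n \<phi> (\<lambda>i. act n f z i + (- N * p) * act n f v i)"
        by (intro pairing_cong) (simp add: fwi)
      then show ?thesis unfolding pairing_add_scale by (simp add: q_def c_def)
    qed
    define s where "s = - (N * N * p * c)"
    have s0: "s \<noteq> 0" using N1 p c0 by (simp add: s_def)
    have "\<bar>x i / s - v i\<bar> < r" if i: "i < n" for i
    proof -
      have xs: "x i / s - v i = (act n f z i - N * p * act n f v i + N * q * v i) / s"
      proof -
        have "x i = (act n f z i - N * p * act n f v i + N * q * v i) + v i * s"
          using x i by (simp add: fwi pfw s_def algebra_simps)
        then show ?thesis using s0 by (simp add: add_divide_distrib)
      qed
      have "\<bar>act n f z i - N * p * act n f v i + N * q * v i\<bar>
          \<le> \<bar>act n f z i\<bar> + \<bar>N * p * act n f v i\<bar> + \<bar>N * q * v i\<bar>" by linarith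
      also have "\<dots> = \<bar>act n f z i\<bar> + N * \<bar>p\<bar> * \<bar>act n f v i\<bar> + N * \<bar>q\<bar> * \<bar>v i\<bar>"
        using N1 by (simp add: abs_mult)
      also have "\<dots> \<le> N * (C i * \<bar>p\<bar>) + N * \<bar>p\<bar> * \<bar>act n f v i\<bar> + N * (Q * \<bar>p\<bar>) * \<bar>v i\<bar>"
      proof (intro add_mono mult_right_mono mult_left_mono qQ)
        have "1 * (C i * \<bar>p\<bar>) \<le> N * (C i * \<bar>p\<bar>)" using N1 C0[of i] by (intro mult_right_mono) auto
        then show "\<bar>act n f z i\<bar> \<le> N * (C i * \<bar>p\<bar>)" using fz[OF i] by linarith
      qed (use N1 in auto)
      also have "\<dots> = N * \<bar>p\<bar> * A i" by (simp add: A_def algebra_simps)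
      also have "\<dots> \<le> N * \<bar>p\<bar> * S" using AS[OF i] N1 by (intro mult_left_mono) auto
      also have "\<dots> < N * \<bar>p\<bar> * (N * \<bar>c\<bar> * r)" using NS N1 p by (intro mult_strict_left_mono) auto
      also have "\<dots> = r * \<bar>s\<bar>" using N1 by (simp add: s_def abs_mult)
      finally show ?thesis unfolding xs abs_divide using s0 by (simp add: pos_divide_less_eq)
    qed
    then show ?thesis unfolding cone_around_def near_def using s0 by blast
  qed
  then show ?thesis unfolding eventually_at_top_linorder by blast
qed

section \<open>Scalar matrices\<close>

definition scalars :: "nat \<Rightarrow> int mat set" where
  "scalars n = {g \<in> carrier (SLZ n). \<exists>c. g = c \<cdot>\<^sub>m 1\<^sub>m n}"

lemma scalars_central:
  assumes "z \<in> scalars n" "g \<in> carrier (SLZ n)"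
  shows "z \<otimes>\<^bsub>SLZ n\<^esub> g = g \<otimes>\<^bsub>SLZ n\<^esub> z"
proof -
  obtain c where "z = c \<cdot>\<^sub>m 1\<^sub>m n" using assms by (auto simp: scalars_def)
  moreover from assms have g: "g \<in> carrier_mat n n" by (simp add: carrier_SLZ_iff)
  moreover have "c \<cdot>\<^sub>m 1\<^sub>m n * g = c \<cdot>\<^sub>m g" "g * (c \<cdot>\<^sub>m 1\<^sub>m n) = c \<cdot>\<^sub>m g"
    using left_mult_one_mat[OF g] right_mult_one_mat[OF g]
      mult_smult_assoc_mat[OF one_carrier_mat g, of c] mult_smult_distrib[OF g one_carrier_mat, of c] by auto
  ultimately show ?thesis by simp
qed

lemma smult_one_mult:
  "(c \<cdot>\<^sub>m 1\<^sub>m n) * (d \<cdot>\<^sub>m 1\<^sub>m n) = (c * d :: int) \<cdot>\<^sub>m (1\<^sub>m n)"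
proof -
  have "(c \<cdot>\<^sub>m 1\<^sub>m n) * (d \<cdot>\<^sub>m 1\<^sub>m n) = c \<cdot>\<^sub>m (1\<^sub>m n * (d \<cdot>\<^sub>m 1\<^sub>m n))"
    by (rule mult_smult_assoc_mat[of _ n n _ n]) auto
  also have "1\<^sub>m n * (d \<cdot>\<^sub>m 1\<^sub>m n) = d \<cdot>\<^sub>m (1\<^sub>m n)" by (rule left_mult_one_mat[of _ n n]) simp
  also have "c \<cdot>\<^sub>m \<dots> = (c * d) \<cdot>\<^sub>m (1\<^sub>m n)" by (intro eq_matI) auto
  finally show ?thesis .
qed

lemma scalar_square:
  assumes "c \<cdot>\<^sub>m 1\<^sub>m n \<in> carrier (SLZ n)"
  shows "n = 0 \<or> c * c = 1"
proof -
  have "c ^ n = 1" using assms by (simp add: carrier_SLZ_iff)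
  then have "\<bar>c\<bar> ^ n = 1" by (metis abs_1 power_abs)
  then have "n = 0 \<or> \<bar>c\<bar> = 1" using power_eq_iff_eq_base[of n "\<bar>c\<bar>" 1] by auto
  then show ?thesis by (auto simp: abs_if split: if_splits)
qed

lemma subgroup_scalars: "subgroup (scalars n) (SLZ n)"
proof -
  interpret group "SLZ n" by (rule group_SLZ)
  show ?thesis
  proof (rule subgroupI)
    show "scalars n \<subseteq> carrier (SLZ n)" by (auto simp: scalars_def)
    have "1\<^sub>m n = 1 \<cdot>\<^sub>m (1\<^sub>m n :: int mat)" by (intro eq_matI) auto
    then have "1\<^sub>m n \<in> scalars n" using one_closed unfolding scalars_def by auto
    then show "scalars n \<noteq> {}" by blast
  next
    fix z assume z: "z \<in> scalars n"
    then obtain c where c: "z = c \<cdot>\<^sub>m 1\<^sub>m n" and zc: "z \<in> carrier (SLZ n)" by (auto simp: scalars_def)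
    have "z * z = 1\<^sub>m n"
      using scalar_square[of c n] zc unfolding c smult_one_mult by (auto intro!: eq_matI)
    then have "inv\<^bsub>SLZ n\<^esub> z = z" by (rule inv_SLZ_eqI[OF zc zc])
    then show "inv\<^bsub>SLZ n\<^esub> z \<in> scalars n" using z by simp
  next
    fix y z assume "y \<in> scalars n" "z \<in> scalars n"
    then show "y \<otimes>\<^bsub>SLZ n\<^esub> z \<in> scalars n"
      using m_closed[of y z] smult_one_mult by (fastforce simp: scalars_def)
  qed
qed

lemma act_scalar:
  assumes "i < n"
  shows "act n (c \<cdot>\<^sub>m 1\<^sub>m n) y i = of_int c * y i"
proof -
  have "act n (c \<cdot>\<^sub>m 1\<^sub>m n) y i = (\<Sum>j<n. if j = i then of_int c * y j else 0)"
    unfolding act_def if_P[OF assms] using assms by (intro sum.cong) auto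
  then show ?thesis using assms by simp
qed

lemma pairing_act_scalar:
  assumes "z \<in> scalars n"
  shows "\<exists>c. c \<noteq> 0 \<and> (\<forall>y. \<forall>i<n. act n z y i = c * y i) \<and> (\<forall>\<chi> y. pairing n \<chi> (act n z y) = c * pairing n \<chi> y)"
proof -
  obtain c where c: "z = c \<cdot>\<^sub>m 1\<^sub>m n" "z \<in> carrier (SLZ n)" using assms by (auto simp: scalars_def)
  show ?thesis
  proof (cases "n = 0")
    case True
    then show ?thesis by (intro exI[of _ 1]) (simp add: pairing_def)
  next
    case False
    then have "c \<noteq> 0" using scalar_square[of c n] c by auto
    moreover have "pairing n \<chi> (act n z y) = of_int c * pairing n \<chi> y" for \<chi> y
      unfolding pairing_scale[symmetric] c(1) by (intro pairing_cong act_scalar)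
    ultimately show ?thesis using act_scalar c(1) by (intro exI[of _ "of_int c"]) auto
  qed
qed

section \<open>Subgroups displacing a vector from a hyperplane\<close>

text \<open>
Incidence of the pair provides the transvections along it, which exclude the whole group and supply
the next conjugator. Scalars are exempt because they preserve every hyperplane; having them in
\<open>H\<close> lets a scalar that arises as a product of two letters of the finite group be absorbed.
\<close>

definition displacing :: "nat \<Rightarrow> int mat set \<Rightarrow> bool" where
  "displacing n H \<longleftrightarrow> subgroup H (SLZ n) \<and> scalars n \<subseteq> H \<and>
     (\<exists>v \<phi> r. r > 0 \<and> generic_flag n v \<phi> \<and> transversal n v \<phi> r (H - scalars n))"

lemma displacing_scalars:
  assumes n: "n \<ge> 2"
  shows "displacing n (scalars n)"
proof -
  define \<phi> :: "nat \<Rightarrow> rat" where "\<phi> = (\<lambda>i. if i = 0 then 1 - of_nat n else 1)"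
  have "pairing n \<phi> (\<lambda>_. 1) = (\<Sum>i<n. 1 + (if i = 0 then - of_nat n else 0))"
    unfolding pairing_def \<phi>_def by (intro sum.cong) auto
  also have "\<dots> = 0" using n by (simp add: sum.distrib)
  finally have "generic_flag n (\<lambda>_. 1) \<phi>" using n by (auto simp: generic_flag_def \<phi>_def)
  then show ?thesis
    unfolding displacing_def using subgroup_scalars
    by (intro conjI exI[of _ "\<lambda>_. 1"] exI[of _ \<phi>] exI[of _ 1]) (auto simp: transversal_def)
qed

text \<open>
A transvection with the hyperplane \<open>\<phi>\<close> in the direction \<open>v\<close> is not scalar but keeps \<open>v\<close> in
the hyperplane.
\<close>

lemma displacing_proper:
  assumes n: "n \<ge> 2" and H: "displacing n H"
  shows "proper_subgroup H (SLZ n)"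
proof -
  obtain v \<phi> r where r: "r > 0" and inc: "generic_flag n v \<phi>" and tr: "transversal n v \<phi> r (H - scalars n)"
    using H by (auto simp: displacing_def)
  have orth: "pairing n \<phi> v = 0" and nz: "v 0 \<noteq> 0" "\<phi> 1 \<noteq> 0"
    using inc n by (auto simp: generic_flag_def)
  obtain T :: "int \<Rightarrow> int mat" and D where D: "D > 0" and T: "\<And>k. T k \<in> carrier (SLZ n)"
    and actT: "\<And>k y i. i < n \<Longrightarrow> act n (T k) y i = y i + of_int k * D * pairing n \<phi> y * v i"
    using ex_integral_transvections[OF orth] by blast
  have "T 1 \<notin> scalars n"
  proof
    assume "T 1 \<in> scalars n"
    then obtain c where c: "\<And>y i. i < n \<Longrightarrow> act n (T 1) y i = c * y i" using pairing_act_scalar by blast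
    define y :: "nat \<Rightarrow> rat" where "y = (\<lambda>i. if i = 1 then 1 else 0)"
    have "pairing n \<phi> y = (\<Sum>i<n. if i = 1 then \<phi> i else 0)"
      unfolding pairing_def y_def by (intro sum.cong) auto
    then have "pairing n \<phi> y = \<phi> 1" using n by simp
    then have "act n (T 1) y 0 = D * \<phi> 1 * v 0" using actT[of 0 1 y] n by (simp add: y_def)
    moreover have "act n (T 1) y 0 = 0" using c[of 0 y] n by (simp add: y_def)
    ultimately show False using D nz by simp
  qed
  moreover have "pairing n \<phi> (act n (T 1) v) = 0"
  proof -
    have "pairing n \<phi> (act n (T 1) v) = pairing n \<phi> v"
      by (intro pairing_cong) (simp add: actT orth)
    then show ?thesis using orth by simp
  qed
  ultimately have "T 1 \<notin> H"
    using tr near_refl[OF r] unfolding transversal_def by blast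
  then show ?thesis using H T[of 1] by (auto simp: displacing_def proper_subgroup_def)
qed

text \<open>
First \<open>(v, \<phi>)\<close> is adjusted so that all nonscalar elements of the given finite groups move
\<open>v\<close> off the hyperplane. The transvections along \<open>(v, \<phi>)\<close> provide the conjugator. The new
displaced pair \<open>(v', \<phi>')\<close> is a small shear of \<open>(v, \<phi>)\<close>. It has to differ from the old one,
because \<open>v'\<close> must be in general position to \<open>\<phi>\<close> in order to enter the game, and \<open>\<phi>'\<close> in
general position to \<open>v\<close> in order not to vanish on the cone where reduced words end.
\<close>

lemma displacing_extend:
  assumes n: "n \<ge> 2" and H: "displacing n H" and m: "m > 0"
    and fin: "finite \<F>" and F: "\<And>F. F \<in> \<F> \<Longrightarrow> subgroup F (SLZ n) \<and> finite F"
  shows "\<exists>t\<in>carrier (SLZ n). \<forall>F\<in>\<F>.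
    displacing n (generate (SLZ n) (H \<union> conjugate_set (SLZ n) (t [^]\<^bsub>SLZ n\<^esub> (m::nat)) F))"
proof -
  interpret group "SLZ n" by (rule group_SLZ)
  have Hs: "subgroup H (SLZ n)" and ZH: "scalars n \<subseteq> H" using H by (auto simp: displacing_def)
  have Hc: "H \<subseteq> carrier (SLZ n)" by (rule subgroup.subset[OF Hs])
  obtain v0 \<phi>0 r0 where 0: "r0 > 0" "generic_flag n v0 \<phi>0" "transversal n v0 \<phi>0 r0 (H - scalars n)"
    using H by (auto simp: displacing_def)
  define X where "X = \<Union>\<F> - scalars n"
  have X: "finite X" unfolding X_def using fin F by blast
  have Xc: "g \<in> carrier (SLZ n)" if "g \<in> X" for g
    using that F subgroup.subset unfolding X_def by blast
  have Xn: "g \<in> carrier_mat n n \<and> (\<nexists>c. g = c \<cdot>\<^sub>m 1\<^sub>m n)" if "g \<in> X" for g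
    using that Xc[OF that] unfolding X_def scalars_def by (auto simp: carrier_SLZ_iff)
  obtain v \<phi> r where r: "r > 0" and inc: "generic_flag n v \<phi>"
    and subv: "\<And>y. near n v r y \<Longrightarrow> near n v0 r0 y" and sub\<phi>: "\<And>\<chi>. near n \<phi> r \<chi> \<Longrightarrow> near n \<phi>0 r0 \<chi>"
    and trX: "transversal n v \<phi> r X"
    using ex_transversal_finite[OF X Xn 0(2,1)] by blast
  have trH: "pairing n \<chi> (act n h y) \<noteq> 0"
    if "h \<in> H - scalars n" "near n \<phi> r \<chi>" "near n v r y" for h \<chi> y
    using 0(3) that subv sub\<phi> unfolding transversal_def by blast
  have orth: "pairing n \<phi> v = 0" and nz: "v 1 \<noteq> 0" "\<phi> 0 \<noteq> 0"
    using inc n by (auto simp: generic_flag_def)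
  obtain e where e: "e > 0" and small: "\<And>t. \<bar>t\<bar> < e \<Longrightarrow>
      generic_flag n (shear_vector 0 1 t v) (shear_vector 1 0 (- t) \<phi>) \<and>
      near n v (r / 2) (shear_vector 0 1 t v) \<and> near n \<phi> (r / 2) (shear_vector 1 0 (- t) \<phi>)"
    using generic_flag_shear[OF inc, of 0 1 "r / 2"] n r by auto
  define v' where "v' = shear_vector 0 1 (e / 2) v"
  define \<phi>' where "\<phi>' = shear_vector 1 0 (- (e / 2)) \<phi>"
  have inc': "generic_flag n v' \<phi>'" and v'r: "near n v (r / 2) v'" and \<phi>'r: "near n \<phi> (r / 2) \<phi>'"
    using small[of "e / 2"] e by (simp_all add: v'_def \<phi>'_def)
  have p1: "pairing n \<phi> v' = e / 2 * v 1 * \<phi> 0"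
    unfolding v'_def shear_vector_def using n by (subst pairing_update_right) (simp_all add: orth)
  have pv': "pairing n \<phi> v' \<noteq> 0" unfolding p1 using e nz by simp
  have p2: "pairing n \<phi>' v = - (e / 2) * \<phi> 0 * v 1"
    unfolding \<phi>'_def shear_vector_def using n by (subst pairing_update_left) (simp_all add: orth)
  have p\<phi>': "pairing n \<phi>' v \<noteq> 0" unfolding p2 using e nz by simp
  obtain \<rho>1 where \<rho>1: "\<rho>1 > 0"
    "\<And>\<chi> y. near n \<phi> \<rho>1 \<chi> \<Longrightarrow> near n v' \<rho>1 y \<Longrightarrow> pairing n \<chi> y \<noteq> 0"
    using pairing_nonzero_nearby[OF pv'] by blast
  obtain \<rho>2 where \<rho>2: "\<rho>2 > 0"
    "\<And>\<chi> y. near n \<phi>' \<rho>2 \<chi> \<Longrightarrow> near n v \<rho>2 y \<Longrightarrow> pairing n \<chi> y \<noteq> 0"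
    using pairing_nonzero_nearby[OF p\<phi>'] by blast
  define r' where "r' = min (r / 2) (min \<rho>1 \<rho>2)"
  define \<rho> where "\<rho> = min r \<rho>1"
  define \<eta> where "\<eta> = min r \<rho>2"
  have pos: "r' > 0" "\<rho> > 0" "\<eta> > 0" using r \<rho>1(1) \<rho>2(1) by (auto simp: r'_def \<rho>_def \<eta>_def)
  \<comment> \<open>\<open>S\<close> attracts the conjugated finite group, \<open>Tr\<close> consists of the vectors well away from
    the hyperplane, and \<open>Y\<close> is where the words start.\<close>
  define S where "S = cone_around n v \<eta>"
  define Tr where "Tr = {z. pairing n \<phi> z \<noteq> 0 \<and> (\<forall>i<n. \<bar>z i\<bar> \<le> 1 / \<rho> * \<bar>pairing n \<phi> z\<bar>)}"
  define Y where "Y = {y. near n v' r' y}"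
  have TrI: "z \<in> Tr" if "\<And>\<chi>. near n \<phi> \<rho> \<chi> \<Longrightarrow> pairing n \<chi> z \<noteq> 0" for z
    using that near_refl[OF pos(2)] nonvanishing_on_ball_bound[OF pos(2) that] by (simp add: Tr_def)
  have "\<forall>\<^sub>F N in at_top. \<forall>f\<in>X. \<forall>z w x. pairing n \<phi> z \<noteq> 0 \<longrightarrow>
      (\<forall>i<n. \<bar>z i\<bar> \<le> 1 / \<rho> * \<bar>pairing n \<phi> z\<bar>) \<longrightarrow>
      (\<forall>i<n. w i = z i - N * pairing n \<phi> z * v i) \<longrightarrow>
      (\<forall>i<n. x i = act n f w i + N * pairing n \<phi> (act n f w) * v i) \<longrightarrow> x \<in> cone_around n v \<eta>"
  proof (rule eventually_ball_finite[OF X], rule ballI)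
    fix f assume f: "f \<in> X"
    have "pairing n \<phi> (act n f v) \<noteq> 0"
      using trX f near_refl[OF r] unfolding transversal_def by blast
    then show "\<forall>\<^sub>F N in at_top. \<forall>z w x. pairing n \<phi> z \<noteq> 0 \<longrightarrow>
      (\<forall>i<n. \<bar>z i\<bar> \<le> 1 / \<rho> * \<bar>pairing n \<phi> z\<bar>) \<longrightarrow>
      (\<forall>i<n. w i = z i - N * pairing n \<phi> z * v i) \<longrightarrow>
      (\<forall>i<n. x i = act n f w i + N * pairing n \<phi> (act n f w) * v i) \<longrightarrow> x \<in> cone_around n v \<eta>"
      using pos by (intro conjugate_contracts orth) auto
  qed
  then obtain N0 where N0: "\<And>N f z w x. N \<ge> N0 \<Longrightarrow> f \<in> X \<Longrightarrow> pairing n \<phi> z \<noteq> 0 \<Longrightarrow>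
      \<forall>i<n. \<bar>z i\<bar> \<le> 1 / \<rho> * \<bar>pairing n \<phi> z\<bar> \<Longrightarrow>
      \<forall>i<n. w i = z i - N * pairing n \<phi> z * v i \<Longrightarrow>
      \<forall>i<n. x i = act n f w i + N * pairing n \<phi> (act n f w) * v i \<Longrightarrow> x \<in> S"
    unfolding eventually_at_top_linorder S_def by metis
  obtain T :: "int \<Rightarrow> int mat" and D where D: "D > 0" and T: "\<And>k. T k \<in> carrier (SLZ n)"
    and T0: "T 0 = 1\<^sub>m n" and Tadd: "\<And>k l. T k * T l = T (k + l)"
    and actT: "\<And>k y i. i < n \<Longrightarrow> act n (T k) y i = y i + of_int k * D * pairing n \<phi> y * v i"
    using ex_integral_transvections[OF orth] by metis
  have Tpow: "T k [^]\<^bsub>SLZ n\<^esub> (l::nat) = T (k * int l)" for k l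
    by (induction l) (simp_all add: T0 Tadd algebra_simps)
  define k where "k = max 0 \<lceil>N0 / D\<rceil>"
  define N where "N = of_int (k * int m) * D"
  have "N0 / D \<le> of_int k" unfolding k_def by (meson le_of_int_ceiling max.cobounded2 of_int_le_iff order_trans)
  then have "N0 \<le> of_int k * D" using D by (simp add: pos_divide_le_eq)
  also have "\<dots> \<le> N"
  proof -
    have "k * 1 \<le> k * int m" using m by (intro mult_left_mono) (auto simp: k_def)
    then have "rat_of_int k \<le> of_int (k * int m)" by (simp only: of_int_le_iff mult_1_right)
    then show ?thesis unfolding N_def using D by (intro mult_right_mono) auto
  qed
  finally have NN0: "N \<ge> N0" .
  define \<gamma> where "\<gamma> = T (k * int m)"
  have \<gamma>: "\<gamma> = T k [^]\<^bsub>SLZ n\<^esub> m" "\<gamma> \<in> carrier (SLZ n)" unfolding \<gamma>_def Tpow using T by auto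
  have inv\<gamma>: "inv\<^bsub>SLZ n\<^esub> \<gamma> = T (- (k * int m))"
    unfolding \<gamma>_def by (rule inv_SLZ_eqI) (auto simp: T Tadd T0)
  have act_m: "act n (g \<otimes>\<^bsub>SLZ n\<^esub> h) x = act n g (act n h x)"
    if "g \<in> carrier (SLZ n)" "h \<in> carrier (SLZ n)" for g h x
    using that act_mult by (simp add: carrier_SLZ_iff)
  have "displacing n (generate (SLZ n) (H \<union> conjugate_set (SLZ n) \<gamma> F))" if FF: "F \<in> \<F>" for F
  proof -
    define F' where "F' = conjugate_set (SLZ n) \<gamma> F"
    define K where "K = generate (SLZ n) (H \<union> F')"
    have Fs: "subgroup F (SLZ n)" using F FF by blast
    have F's: "subgroup F' (SLZ n)" unfolding F'_def by (rule subgroup_conjugate_set[OF Fs \<gamma>(2)])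
    have Kc: "H \<union> F' \<subseteq> carrier (SLZ n)" using Hc subgroup.subset[OF F's] by blast
    have Ks: "subgroup K (SLZ n)" unfolding K_def by (rule generate_is_subgroup[OF Kc])
    have HK: "H \<subseteq> K" unfolding K_def by (auto intro: generate.incl)
    have HS: "act n h x \<in> Tr" if h: "h \<in> H - scalars n" and x: "x \<in> S" for h x
    proof -
      obtain s where s: "s \<noteq> 0" "near n v \<eta> (\<lambda>i. x i / s)" using x by (auto simp: S_def cone_around_def)
      have xs: "x = (\<lambda>i. s * (x i / s))" using s(1) by simp
      show ?thesis
      proof (rule TrI)
        fix \<chi> assume \<chi>: "near n \<phi> \<rho> \<chi>"
        have "pairing n \<chi> (act n h (\<lambda>i. x i / s)) \<noteq> 0"
          using near_mono[OF \<chi>, of r] near_mono[OF s(2), of r] by (intro trH[OF h]) (auto simp: \<rho>_def \<eta>_def)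
        moreover have "act n h x = (\<lambda>i. s * act n h (\<lambda>i. x i / s) i)"
          by (subst xs) (rule ext, rule act_scale)
        ultimately show "pairing n \<chi> (act n h x) \<noteq> 0" using s(1) by simp
      qed
    qed
    have HY: "act n h y \<in> Tr" if h: "h \<in> H" and y: "y \<in> Y" for h y
    proof (rule TrI)
      fix \<chi> assume \<chi>: "near n \<phi> \<rho> \<chi>"
      have y': "near n v' r' y" using y by (simp add: Y_def)
      show "pairing n \<chi> (act n h y) \<noteq> 0"
      proof (cases "h \<in> scalars n")
        case True
        then obtain c where "c \<noteq> 0" "pairing n \<chi> (act n h y) = c * pairing n \<chi> y"
          using pairing_act_scalar by blast
        moreover have "pairing n \<chi> y \<noteq> 0"
          using near_mono[OF \<chi>, of \<rho>1] near_mono[OF y', of \<rho>1]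
          by (intro \<rho>1(2)) (auto simp: \<rho>_def r'_def)
        ultimately show ?thesis by simp
      next
        case False
        have "near n v r y" by (rule near_subball[OF v'r _ y']) (simp add: r'_def)
        then show ?thesis using near_mono[OF \<chi>, of r] h False by (intro trH) (auto simp: \<rho>_def)
      qed
    qed
    have FT: "act n f' z \<in> S" if f': "f' \<in> F' - scalars n" and z: "z \<in> Tr" for f' z
    proof -
      obtain f where f: "f \<in> F" "f' = \<gamma> \<otimes>\<^bsub>SLZ n\<^esub> f \<otimes>\<^bsub>SLZ n\<^esub> inv\<^bsub>SLZ n\<^esub> \<gamma>"
        using f' by (auto simp: F'_def conjugate_set_def)
      have fc: "f \<in> carrier (SLZ n)" by (rule subgroup.mem_carrier[OF Fs f(1)])
      have "f \<notin> scalars n"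
      proof
        assume fZ: "f \<in> scalars n"
        have "f' = f" using f(2) scalars_central[OF fZ \<gamma>(2), symmetric] fc \<gamma>(2)
          by (simp add: m_assoc r_inv del: mult_SLZ one_SLZ)
        then show False using f' fZ by blast
      qed
      then have fX: "f \<in> X" using f FF by (auto simp: X_def)
      define w where "w = act n (T (- (k * int m))) z"
      have x: "act n f' z = act n \<gamma> (act n f w)"
        using f(2) act_m fc \<gamma>(2) T inv\<gamma> by (simp add: w_def del: mult_SLZ)
      have zT: "pairing n \<phi> z \<noteq> 0" "\<forall>i<n. \<bar>z i\<bar> \<le> 1 / \<rho> * \<bar>pairing n \<phi> z\<bar>"
        using z by (auto simp: Tr_def)
      show ?thesis
      proof (rule N0[OF NN0 fX zT])
        show "\<forall>i<n. w i = z i - N * pairing n \<phi> z * v i"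
          by (simp add: w_def actT N_def)
        show "\<forall>i<n. act n f' z i = act n f w i + N * pairing n \<phi> (act n f w) * v i"
          by (simp add: x \<gamma>_def actT N_def)
      qed
    qed
    have "transversal n v' \<phi>' r' (K - scalars n)"
      unfolding transversal_def
    proof (intro ballI allI impI)
      fix g \<chi> y assume g: "g \<in> K - scalars n" and \<chi>: "near n \<phi>' r' \<chi>" and y: "near n v' r' y"
      have \<chi>r: "near n \<phi> r \<chi>" by (rule near_subball[OF \<phi>'r _ \<chi>]) (simp add: r'_def)
      show "pairing n \<chi> (act n g y) \<noteq> 0"
      proof (cases "g \<in> H")
        case True
        have "near n v r y" by (rule near_subball[OF v'r _ y]) (simp add: r'_def)
        then show ?thesis using g True \<chi>r by (intro trH) auto
      next
        case False
        \<comment> \<open>By ping-pong the image of \<open>y\<close> is in a translate of the cone by some \<open>h \<in> H\<close>. If \<open>h\<close>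
          is scalar the choice of \<open>\<phi>'\<close> applies, otherwise the displacing property of \<open>H\<close>.\<close>
        have "\<exists>h\<in>H. \<forall>y\<in>Y. \<exists>x\<in>S. act n g y = act n h x"
          using g False unfolding K_def
          by (intro ping_pong[where act = "act n" and T = Tr, OF Hs F's subgroup_scalars ZH
                scalars_central act_m HS FT HY]) auto
        then obtain h x where h: "h \<in> H" and x: "x \<in> S" and gx: "act n g y = act n h x"
          using y by (auto simp: Y_def)
        obtain s where s: "s \<noteq> 0" "near n v \<eta> (\<lambda>i. x i / s)" using x by (auto simp: S_def cone_around_def)
        have xs: "x = (\<lambda>i. s * (x i / s))" using s(1) by simp
        have "act n h x = (\<lambda>i. s * act n h (\<lambda>i. x i / s) i)"
          by (subst xs) (rule ext, rule act_scale)
        then have eq: "pairing n \<chi> (act n g y) = s * pairing n \<chi> (act n h (\<lambda>i. x i / s))"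
          by (simp add: gx)
        have "pairing n \<chi> (act n h (\<lambda>i. x i / s)) \<noteq> 0"
        proof (cases "h \<in> scalars n")
          case True
          then obtain c where "c \<noteq> 0" "pairing n \<chi> (act n h (\<lambda>i. x i / s)) = c * pairing n \<chi> (\<lambda>i. x i / s)"
            using pairing_act_scalar by blast
          moreover have "pairing n \<chi> (\<lambda>i. x i / s) \<noteq> 0"
            using near_mono[OF \<chi>, of \<rho>2] near_mono[OF s(2), of \<rho>2]
            by (intro \<rho>2(2)) (auto simp: \<eta>_def r'_def)
          ultimately show ?thesis by simp
        next
          case False
          then show ?thesis
            using h \<chi>r near_mono[OF s(2), of r] by (intro trH) (auto simp: \<eta>_def)
        qed
        then show ?thesis unfolding eq using s(1) by simp
      qed
    qed
    then have "displacing n K"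
      unfolding displacing_def using Ks ZH HK inc' pos(1) by blast
    then show ?thesis by (simp add: K_def F'_def)
  qed
  then show ?thesis using T[of k] \<gamma>(1) by blast
qed

lemma countable_carrier_mat: "countable (carrier_mat n m :: int mat set)"
proof -
  have "(carrier_mat n m :: int mat set) \<subseteq>
      (\<lambda>xs. mat n m (\<lambda>(i, j). xs ! i ! j)) ` (UNIV :: int list list set)"
  proof
    fix g :: "int mat" assume g: "g \<in> carrier_mat n m"
    have "g = mat n m (\<lambda>(i, j). map (\<lambda>i. map (\<lambda>j. g $$ (i, j)) [0..<m]) [0..<n] ! i ! j)"
      using g by (intro eq_matI) auto
    then show "g \<in> (\<lambda>xs. mat n m (\<lambda>(i, j). xs ! i ! j)) ` (UNIV :: int list list set)" by blast
  qed
  then show ?thesis by (meson countable_image countable_subset uncountable_def countableI_type)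
qed

section \<open>The number of maximal subgroups of infinite index\<close>

theorem theorem1p1:
  fixes n :: nat
  assumes "n \<ge> 3"
  shows "{M. maximal_subgroup M (SLZ n) \<and> infinite_index M (SLZ n)} \<approx> (UNIV :: nat set set)"
proof (rule lepoll_antisym)
  let ?M = "{M. maximal_subgroup M (SLZ n) \<and> infinite_index M (SLZ n)}"
  interpret group "SLZ n" by (rule group_SLZ)
  obtain c :: "int mat \<Rightarrow> nat" where c: "inj_on c (carrier (SLZ n))"
    using countable_carrier_mat[of n n] countable_subset[of "carrier (SLZ n)" "carrier_mat n n"]
    unfolding countable_def by (auto simp: carrier_SLZ_iff subset_iff)
  have "?M \<subseteq> Pow (carrier (SLZ n))"
    using subgroup.subset by (auto simp: maximal_subgroup_def proper_subgroup_def)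
  moreover have "inj_on (image c) (Pow (carrier (SLZ n)))" using c by (rule inj_on_image_Pow)
  ultimately show "?M \<lesssim> (UNIV :: nat set set)"
    unfolding lepoll_def using inj_on_subset by blast
  let ?A = "signed_permutations n" and ?B = "{1\<^sub>m n, shear_reflection n}"
  have "\<exists>M :: nat set \<Rightarrow> int mat set. inj M \<and> range M \<subseteq> ?M"
  proof (rule continuum_many_maximal_subgroups[where P = "displacing n"])
    show "finite ?A" by (rule finite_signed_permutations)
    show "finite ?B" by simp
    show "?A \<subseteq> carrier (SLZ n)" by (rule subgroup.subset[OF subgroup_signed_permutations])
    show "?B \<subseteq> carrier (SLZ n)" by (rule subgroup.subset[OF subgroup_shear_reflection[OF assms]])
    show "generate (SLZ n) (?A \<union> ?B) = carrier (SLZ n)" by (rule generate_SLZ[OF assms])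
    show "displacing n (scalars n)" using assms by (intro displacing_scalars) simp
    show "proper_subgroup H (SLZ n)" if "displacing n H" for H
      using assms that by (intro displacing_proper) simp
    show "\<exists>t\<in>carrier (SLZ n). \<forall>F\<in>{?A, ?B}.
        displacing n (generate (SLZ n) (H \<union> conjugate_set (SLZ n) (t [^]\<^bsub>SLZ n\<^esub> m) F))"
      if "displacing n H" "m > 0" for H and m :: nat
      using assms that finite_signed_permutations subgroup_signed_permutations
        subgroup_shear_reflection[OF assms]
      by (intro displacing_extend) auto
  qed
  then show "(UNIV :: nat set set) \<lesssim> ?M" unfolding lepoll_def by blast
qed

end
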